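(* Let $n\ge 2$, let $M,N\in\mathbb{Z}^{n-1}$ and let $D=(D_1,\dots,D_{n-1})$ be a tuple of positive integers. If $D_1,\dots,D_{n-1}$ are pairwise coprime, then the long Weyl element Kloosterman sums satisfy $$S_n(M,N;D)=\prod_{i=1}^{n-1}S_2(D_{i-1}M_iD_{i+1},N_i;D_i),$$ with the convention $D_0=1$ and $D_n=1$.
   Context: Definition of $S_n(M,N;D)$ for any $n\ge2$, $M,N\in\mathbb{Z}^{n-1}$ and $D$ an $(n-1)$-tuple of positive integers: $e(z)=e^{2\pi i z}$. $U$ is the group of upper triangular unipotent $n\times n$ matrices. For $N\in\mathbb{Z}^{n-1}$, $\psi_N$ is the character of $U(\mathbb{R})$, trivial on $U(\mathbb{Z})$, given by $\psi_N(u)=e(N_1u_{1,2}+N_2u_{2,3}+\cdots+N_{n-1}u_{n-1,n})$. For $M\in \mathbb{Z}^{n-1}$, $\tilde M=(M_{n-1},\dots,M_1)$. Let $w_0$ be the long Weyl element: the $n\times n$ matrix whose only nonzero entries are on the anti-diagonal, the entry at position $(n-k+1,k)$ being $(-1)^{k-1}$ ($1\le k\le n$). Let $c=\mathrm{Diag}(1/D_{n-1},\,D_{n-1}/D_{n-2},\dots,D_2/D_1,\,D_1)$, $C(c)=U(\mathbb{R})\,c\,w_0\,U(\mathbb{R})\cap SL(n,\mathbb{Z})$ and $X(c)=U(\mathbb{Z})\backslash C(c)/U(\mathbb{Z})$. Each $\gamma\in C(c)$ is uniquely $\gamma=b_1cw_0b_2$ with $b_1,b_2\in U(\mathbb{R})$;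 set $\mu(\gamma)=b_1\in U(\mathbb{Z})\backslash U(\mathbb{R})$ and $\mu'(\gamma)=b_2\in U(\mathbb{R})/U(\mathbb{Z})$. Then $$S_n(M,N;D)=\sum_{x\in X(c)}\psi_{\tilde M}(\mu(x))\,\psi_N(\mu'(x)).$$ For $n=2$ the arguments are integers (1-tuples). *)

theory Defs
  imports Complex_Main "Jordan_Normal_Form.Determinant"
begin

text \<open>
  An \<open>(n-1)\<close>-tuple is a function on \<open>nat\<close> of which only the values at \<open>1, \<dots>, n-1\<close> matter.
  Matrix entries are indexed from 0, so the mathematical entry \<open>u\<^sub>i\<^sub>,\<^sub>j\<close> is \<open>u $$ (i-1, j-1)\<close>.
  Integral matrices are regarded as real matrices with entries in \<open>\<int>\<close>.
\<close>

definition unipotent :: "nat \<Rightarrow> real mat set" where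
  "unipotent n = {u \<in> carrier_mat n n. upper_triangular u \<and> (\<forall>i<n. u $$ (i, i) = 1)}"

definition unipotent_int :: "nat \<Rightarrow> real mat set" where
  "unipotent_int n = {u \<in> unipotent n. elements_mat u \<subseteq> \<int>}"

definition SL_int :: "nat \<Rightarrow> real mat set" where
  "SL_int n = {g \<in> carrier_mat n n. elements_mat g \<subseteq> \<int> \<and> det g = 1}"

definition cexp2pi :: "real \<Rightarrow> complex" where
  "cexp2pi z = exp (2 * complex_of_real pi * \<i> * complex_of_real z)"

definition psi :: "nat \<Rightarrow> (nat \<Rightarrow> int) \<Rightarrow> real mat \<Rightarrow> complex" where
  "psi n N u = cexp2pi (\<Sum>i = 1..n-1. real_of_int (N i) * u $$ (i - 1, i))"

definition reverse_tuple :: "nat \<Rightarrow> (nat \<Rightarrow> int) \<Rightarrow> nat \<Rightarrow> int" where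
  "reverse_tuple n M i = M (n - i)"

text \<open>The convention \<open>D\<^sub>0 = D\<^sub>n = 1\<close>.\<close>

definition extend_tuple :: "nat \<Rightarrow> (nat \<Rightarrow> nat) \<Rightarrow> nat \<Rightarrow> nat" where
  "extend_tuple n D i = (if i = 0 \<or> i = n then 1 else D i)"

definition long_weyl :: "nat \<Rightarrow> real mat" where
  "long_weyl n = mat n n (\<lambda>(i, j). if i + j = n - 1 then (-1) ^ j else 0)"

text \<open>
  With the convention above, the \<open>k\<close>-th diagonal entry of \<open>c\<close> is \<open>D\<^sub>n\<^sub>-\<^sub>k\<^sub>+\<^sub>1 / D\<^sub>n\<^sub>-\<^sub>k\<close> for all \<open>1 \<le> k \<le> n\<close>;
  here \<open>k = i + 1\<close>.
\<close>

definition torus_element :: "nat \<Rightarrow> (nat \<Rightarrow> nat) \<Rightarrow> real mat" where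
  "torus_element n D =
     mat_diag n (\<lambda>i. real (extend_tuple n D (n - i)) / real (extend_tuple n D (n - i - 1)))"

definition bruhat_cell :: "nat \<Rightarrow> (nat \<Rightarrow> nat) \<Rightarrow> real mat set" where
  "bruhat_cell n D =
     {b1 * torus_element n D * long_weyl n * b2 | b1 b2. b1 \<in> unipotent n \<and> b2 \<in> unipotent n}
       \<inter> SL_int n"

definition double_coset_rel :: "nat \<Rightarrow> (nat \<Rightarrow> nat) \<Rightarrow> (real mat \<times> real mat) set" where
  "double_coset_rel n D =
     {(g, h). g \<in> bruhat_cell n D \<and> h \<in> bruhat_cell n D \<and>
        (\<exists>u \<in> unipotent_int n. \<exists>v \<in> unipotent_int n. h = u * g * v)}"

definition kloosterman_set :: "nat \<Rightarrow> (nat \<Rightarrow> nat) \<Rightarrow> real mat set set" where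
  "kloosterman_set n D = bruhat_cell n D // double_coset_rel n D"

definition mu :: "nat \<Rightarrow> (nat \<Rightarrow> nat) \<Rightarrow> real mat \<Rightarrow> real mat" where
  "mu n D g = (THE b1. b1 \<in> unipotent n \<and>
     (\<exists>b2 \<in> unipotent n. g = b1 * torus_element n D * long_weyl n * b2))"

definition mu' :: "nat \<Rightarrow> (nat \<Rightarrow> nat) \<Rightarrow> real mat \<Rightarrow> real mat" where
  "mu' n D g = (THE b2. b2 \<in> unipotent n \<and>
     (\<exists>b1 \<in> unipotent n. g = b1 * torus_element n D * long_weyl n * b2))"

text \<open>
  The characters are trivial on integral unipotent matrices, so each factor is constant on
  a double coset \<open>x\<close>; \<^const>\<open>the_elem\<close> extracts that common value.
\<close>

definition kloosterman_sum ::
    "nat \<Rightarrow> (nat \<Rightarrow> int) \<Rightarrow> (nat \<Rightarrow> int) \<Rightarrow> (nat \<Rightarrow> nat) \<Rightarrow> complex" where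
  "kloosterman_sum n M N D =
     (\<Sum>x \<in> kloosterman_set n D.
        the_elem ((\<lambda>g. psi n (reverse_tuple n M) (mu n D g)) ` x) *
        the_elem ((\<lambda>g. psi n N (mu' n D g)) ` x))"

definition kloosterman_sum2 :: "int \<Rightarrow> int \<Rightarrow> nat \<Rightarrow> complex" where
  "kloosterman_sum2 m k d = kloosterman_sum 2 (\<lambda>_. m) (\<lambda>_. k) (\<lambda>_. d)"

end

theory Submission
  imports Defs "HOL-Number_Theory.Cong"
begin

text \<open>
  Reversing the order of the rows turns \<open>\<gamma> = b\<^sub>1 c w\<^sub>0 b\<^sub>2\<close> into an LDU decomposition, so \<open>D\<^sub>k\<close> is the
  \<open>k\<close>-th bottom left corner minor of \<open>\<gamma>\<close>, and by Cramer's rule \<open>\<alpha>\<^sub>k = D\<^sub>k (b\<^sub>1)\<^sub>n\<^sub>-\<^sub>k\<^sub>,\<^sub>n\<^sub>-\<^sub>k\<^sub>+\<^sub>1\<close> and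
  \<open>\<beta>\<^sub>k = D\<^sub>k (b\<^sub>2)\<^sub>k\<^sub>,\<^sub>k\<^sub>+\<^sub>1\<close> are integers with \<open>\<alpha>\<^sub>k \<beta>\<^sub>k \<equiv> D\<^sub>k\<^sub>-\<^sub>1 D\<^sub>k\<^sub>+\<^sub>1\<close> modulo \<open>D\<^sub>k\<close>. For pairwise
  coprime moduli the residues \<open>(\<alpha>\<^sub>k, \<beta>\<^sub>k)\<close> are a complete invariant of the double coset of \<open>\<gamma>\<close>:
  at each prime only one \<open>D\<^sub>k\<close> can fail to be a unit, and then \<open>b\<^sub>2\<close> agrees, up to a factor with
  \<open>p\<close>-integral entries, with a matrix in the \<open>k\<close>-th simple root subgroup; conversely every choice of
  residues is realised by an induction on \<open>n\<close> that inserts one block of \<open>SL\<^sub>2(\<int>)\<close> at a time.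
  Hence \<open>S\<^sub>n\<close> is a sum over a product set, and replacing \<open>\<alpha>\<^sub>k\<close> by \<open>D\<^sub>k\<^sub>-\<^sub>1 D\<^sub>k\<^sub>+\<^sub>1 \<alpha>\<^sub>k\<close> turns its factors
  into classical Kloosterman sums.
\<close>

section \<open>Matrices over subrings of the reals\<close>

text \<open>Three such rings occur: \<int>, the localizations of \<int> at primes, and \<real>
  itself when only the existence of an inverse matters.\<close>

definition real_subring :: "real set \<Rightarrow> bool" where
  "real_subring S \<longleftrightarrow> 1 \<in> S \<and> (\<forall>x\<in>S. \<forall>y\<in>S. x - y \<in> S \<and> x * y \<in> S)"

lemma real_subring_closed:
  assumes "real_subring S"
  shows "0 \<in> S" "1 \<in> S" "x \<in> S \<Longrightarrow> - x \<in> S"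
    "x \<in> S \<Longrightarrow> y \<in> S \<Longrightarrow> x + y \<in> S" "x \<in> S \<Longrightarrow> y \<in> S \<Longrightarrow> x - y \<in> S"
    "x \<in> S \<Longrightarrow> y \<in> S \<Longrightarrow> x * y \<in> S"
proof -
  show 1: "1 \<in> S" using assms by (simp add: real_subring_def)
  have d: "x - y \<in> S" if "x \<in> S" "y \<in> S" for x y
    using assms that by (simp add: real_subring_def)
  show 0: "0 \<in> S" using d[OF 1 1] by simp
  have m: "- x \<in> S" if "x \<in> S" for x using d[OF 0 that] by simp
  show "x \<in> S \<Longrightarrow> - x \<in> S" by (rule m)
  show "x \<in> S \<Longrightarrow> y \<in> S \<Longrightarrow> x + y \<in> S" using d[OF _ m, of x y] by simp
  show "x \<in> S \<Longrightarrow> y \<in> S \<Longrightarrow> x - y \<in> S" by (rule d)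
  show "x \<in> S \<Longrightarrow> y \<in> S \<Longrightarrow> x * y \<in> S" using assms by (simp add: real_subring_def)
qed

lemma real_subring_Ints: "real_subring \<int>"
  by (simp add: real_subring_def)

lemma real_subring_sum:
  assumes "real_subring S" "\<And>i. i \<in> A \<Longrightarrow> f i \<in> S"
  shows "sum f A \<in> S"
  using assms(2) by (induction A rule: infinite_finite_induct)
    (simp_all add: real_subring_closed[OF assms(1)])

lemma real_subring_prod:
  assumes "real_subring S" "\<And>i. i \<in> A \<Longrightarrow> f i \<in> S"
  shows "prod f A \<in> S"
  using assms(2) by (induction A rule: infinite_finite_induct)
    (simp_all add: real_subring_closed[OF assms(1)])

lemma real_subring_of_int:
  assumes "real_subring S" shows "of_int k \<in> S"
proof (induction k rule: int_induct[where k = 0])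
  case base
  then show ?case by (simp add: real_subring_closed[OF assms])
qed (simp_all add: real_subring_closed[OF assms])

lemma real_subring_Ints_subset:
  assumes "real_subring S" shows "\<int> \<subseteq> S"
  using real_subring_of_int[OF assms] by (auto elim: Ints_cases)

lemma elements_mat_subset_iff:
  assumes "A \<in> carrier_mat n m"
  shows "elements_mat A \<subseteq> S \<longleftrightarrow> (\<forall>i<n. \<forall>j<m. A $$ (i, j) \<in> S)"
  using assms by (auto dest!: elements_matD)

lemma mult_mat_entry:
  assumes "A \<in> carrier_mat n m" "B \<in> carrier_mat m k" "i < n" "j < k"
  shows "(A * B) $$ (i, j) = (\<Sum>l<m. A $$ (i, l) * B $$ (l, j))"
  using assms by (auto simp: scalar_prod_def atLeast0LessThan intro!: sum.cong)

lemma elements_mat_mult: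
  assumes S: "real_subring S" and AB: "A \<in> carrier_mat n m" "B \<in> carrier_mat m k"
    and "elements_mat A \<subseteq> S" "elements_mat B \<subseteq> S"
  shows "elements_mat (A * B) \<subseteq> S"
proof -
  have "A * B \<in> carrier_mat n k" using AB by simp
  then show ?thesis using assms(4,5) AB
    unfolding elements_mat_subset_iff[OF \<open>A * B \<in> carrier_mat n k\<close>]
    by (auto simp: elements_mat_subset_iff mult_mat_entry[OF AB]
        simp del: index_mult_mat
        intro!: real_subring_sum[OF S] real_subring_closed(6)[OF S])
qed

lemma det_in_subring:
  assumes S: "real_subring S" and A: "A \<in> carrier_mat n n" "elements_mat A \<subseteq> S"
  shows "det A \<in> S"
  unfolding det_def'[OF A(1)]
proof (rule real_subring_sum[OF S])
  fix p assume "p \<in> {p. p permutes {0..<n}}"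
  then have "p i < n" if "i < n" for i
    using that permutes_in_image[of p "{0..<n}" i] by simp
  then have "(\<Prod>i = 0..<n. A $$ (i, p i)) \<in> S"
    using A by (intro real_subring_prod[OF S]) (simp add: elements_mat_subset_iff)
  then show "signof p * (\<Prod>i = 0..<n. A $$ (i, p i)) \<in> S"
    by (cases "evenperm p") (simp_all add: sign_def real_subring_closed[OF S])
qed

text \<open>Cofactors are signed determinants of submatrices. This is what lets Cramer's rule run
  over any of the rings in use.\<close>

lemma adj_mat_in_subring:
  assumes S: "real_subring S" and A: "A \<in> carrier_mat n n" "elements_mat A \<subseteq> S"
  shows "elements_mat (adj_mat A) \<subseteq> S"
proof -
  have "adj_mat A $$ (i, j) \<in> S" if ij: "i < n" "j < n" for i j
  proof -
    have "mat_delete A j i \<in> carrier_mat (n - 1) (n - 1)"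
      by (rule mat_delete_carrier[OF A(1)])
    moreover have "elements_mat (mat_delete A j i) \<subseteq> S"
      using A(2) ij unfolding elements_mat_subset_iff[OF calculation] elements_mat_subset_iff[OF A(1)]
      using A(1) by (simp add: mat_delete_def)
    ultimately have "det (mat_delete A j i) \<in> S"
      by (rule det_in_subring[OF S])
    moreover have "(- 1) ^ (j + i) \<in> S"
      using real_subring_of_int[OF S, of "(-1) ^ (j + i)"] by simp
    ultimately show ?thesis using A ij
      by (simp add: adj_mat_def cofactor_def real_subring_closed[OF S])
  qed
  then show ?thesis using adj_mat(1)[OF A(1)] by (simp add: elements_mat_subset_iff)
qed

section \<open>Unipotent and antidiagonal matrices\<close>

lemma unipotentD:
  assumes "u \<in> unipotent n"
  shows "u \<in> carrier_mat n n" "\<And>i. i < n \<Longrightarrow> u $$ (i, i) = 1"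
    "\<And>i j. j < i \<Longrightarrow> i < n \<Longrightarrow> u $$ (i, j) = 0"
  using assms by (auto simp: unipotent_def upper_triangular_def)

lemma unipotentI:
  assumes "u \<in> carrier_mat n n" "\<And>i. i < n \<Longrightarrow> u $$ (i, i) = 1"
    "\<And>i j. j < i \<Longrightarrow> i < n \<Longrightarrow> u $$ (i, j) = 0"
  shows "u \<in> unipotent n"
  using assms by (auto simp: unipotent_def upper_triangular_def)

lemma det_unipotent:
  assumes "u \<in> unipotent n" shows "det u = 1"
proof -
  have "upper_triangular u" using assms by (simp add: unipotent_def)
  then show ?thesis
    using assms det_upper_triangular[of u n] unipotentD[OF assms]
    by (simp add: prod_list_diag_prod)
qed

lemma one_unipotent: "1\<^sub>m n \<in> unipotent n"
  by (rule unipotentI) auto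

lemma unipotent_mult_entry:
  assumes u: "u \<in> unipotent n" and X: "X \<in> carrier_mat n k" and ij: "i < n" "j < k"
  shows "(u * X) $$ (i, j) = X $$ (i, j) + (\<Sum>l\<in>{i<..<n}. u $$ (i, l) * X $$ (l, j))"
proof -
  have "(u * X) $$ (i, j) = (\<Sum>l<n. u $$ (i, l) * X $$ (l, j))"
    by (rule mult_mat_entry[OF unipotentD(1)[OF u] X ij])
  also have "\<dots> = (\<Sum>l\<in>{i..<n}. u $$ (i, l) * X $$ (l, j))"
    using unipotentD(3)[OF u _ ij(1)] by (intro sum.mono_neutral_right) auto
  also have "{i..<n} = insert i {i<..<n}" using ij by auto
  finally show ?thesis using unipotentD(2)[OF u ij(1)] by simp
qed

lemma unipotent_mult:
  assumes "u \<in> unipotent n" "v \<in> unipotent n"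
  shows "u * v \<in> unipotent n"
proof (rule unipotentI)
  note v = unipotentD[OF assms(2)]
  show "u * v \<in> carrier_mat n n" using unipotentD(1)[OF assms(1)] v(1) by simp
  show "(u * v) $$ (i, i) = 1" if "i < n" for i
    unfolding unipotent_mult_entry[OF assms(1) v(1) that that]
    using v(2)[OF that] v(3) by simp
  show "(u * v) $$ (i, j) = 0" if "j < i" "i < n" for i j
    using that v(3) by (simp add: unipotent_mult_entry[OF assms(1) v(1)])
qed

text \<open>Row i of \<open>u * X\<close> is row i of \<open>X\<close> plus a combination of lower
  rows, so the entries left of the diagonal vanish row by row from the bottom upwards; then the
  diagonal can be read off.\<close>

lemma unipotent_cancel_left:
  assumes u: "u \<in> unipotent n" and X: "X \<in> carrier_mat n n" and uX: "u * X \<in> unipotent n"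
  shows "X \<in> unipotent n"
proof -
  have low: "X $$ (i, j) = 0" if "j < i" "i < n" for i j
    using that
  proof (induction "n - i" arbitrary: i rule: less_induct)
    case less
    have "0 = (u * X) $$ (i, j)" using unipotentD(3)[OF uX] less.prems by simp
    also have "\<dots> = X $$ (i, j)"
      using less.prems by (subst unipotent_mult_entry[OF u X]) (auto intro!: sum.neutral less.hyps)
    finally show ?case by simp
  qed
  have "X $$ (i, i) = 1" if "i < n" for i
    using unipotentD(2)[OF uX that] low that by (simp add: unipotent_mult_entry[OF u X])
  then show ?thesis using low X by (intro unipotentI)
qed

text \<open>As the determinant is 1, the adjugate is the inverse, and its entries stay in
  \<open>S\<close>; \<open>unipotent_cancel_left\<close> shows that it is unipotent.\<close>

lemma unipotent_inverse:
  assumes S: "real_subring S" and u: "u \<in> unipotent n" "elements_mat u \<subseteq> S"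
  obtains v where "v \<in> unipotent n" "elements_mat v \<subseteq> S" "u * v = 1\<^sub>m n" "v * u = 1\<^sub>m n"
proof
  note c = unipotentD(1)[OF u(1)]
  have [simp]: "1 \<cdot>\<^sub>m 1\<^sub>m n = (1\<^sub>m n :: real mat)" by (rule eq_matI) auto
  note a = adj_mat[OF c, unfolded det_unipotent[OF u(1)]]
  show "u * adj_mat u = 1\<^sub>m n" using a(2) by simp
  show "adj_mat u * u = 1\<^sub>m n" using a(3) by simp
  show "elements_mat (adj_mat u) \<subseteq> S" by (rule adj_mat_in_subring[OF S c u(2)])
  show "adj_mat u \<in> unipotent n"
    by (rule unipotent_cancel_left[OF u(1) a(1)]) (simp add: a(2) one_unipotent)
qed

lemma real_subring_UNIV: "real_subring UNIV"
  by (simp add: real_subring_def)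

section \<open>The antidiagonal factor c w_0\<close>

definition antidiag :: "nat \<Rightarrow> (nat \<Rightarrow> real) \<Rightarrow> real mat" where
  "antidiag n f = mat n n (\<lambda>(i, j). if i + j = n - 1 then (-1) ^ j * f j else 0)"

lemma antidiag_carrier: "antidiag n f \<in> carrier_mat n n"
  by (simp add: antidiag_def)

lemma det_antidiag: "det (antidiag n f) = (\<Prod>l<n. f l)"
proof (induction n arbitrary: f)
  case 0
  then show ?case using det_dim_zero[OF antidiag_carrier] by simp
next
  case (Suc n)
  \<comment> \<open>Deleting column 0 shifts the column index, so every sign (-1)^j flips. The
    resulting factor (-1)^n cancels the cofactor sign at position (n, 0).\<close>
  have md: "mat_delete (antidiag (Suc n) f) n 0 = (-1) \<cdot>\<^sub>m antidiag n (\<lambda>l. f (Suc l))"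
    by (rule eq_matI) (auto simp: antidiag_def mat_delete_def)
  have "det (antidiag (Suc n) f) =
      (\<Sum>i<Suc n. antidiag (Suc n) f $$ (i, 0) * cofactor (antidiag (Suc n) f) i 0)"
    by (rule laplace_expansion_column[OF antidiag_carrier]) simp
  also have "\<dots> = (\<Sum>i\<in>{n}. antidiag (Suc n) f $$ (i, 0) * cofactor (antidiag (Suc n) f) i 0)"
    by (rule sum.mono_neutral_right) (auto simp: antidiag_def)
  also have "\<dots> = f 0 * ((-1) ^ n * ((-1) ^ n * (\<Prod>l<n. f (Suc l))))"
  proof -
    have "dim_col (antidiag n (\<lambda>l. f (Suc l))) = n" by (simp add: antidiag_def)
    then show ?thesis by (simp add: cofactor_def md Suc.IH) (simp add: antidiag_def)
  qed
  also have "\<dots> = f 0 * (\<Prod>l<n. f (Suc l))"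
    by (simp add: mult.assoc[symmetric] power_mult_distrib[symmetric])
  finally show ?case by (subst prod.lessThan_Suc_shift)
qed

text \<open>Up to sign, the nonzero entry of c w_0 in column l. The partial products telescope to
  the D_i.\<close>

definition ratio :: "nat \<Rightarrow> (nat \<Rightarrow> nat) \<Rightarrow> nat \<Rightarrow> real" where
  "ratio n D l = real (extend_tuple n D (Suc l)) / real (extend_tuple n D l)"

lemma torus_long_weyl: "torus_element n D * long_weyl n = antidiag n (ratio n D)"
proof -
  have "long_weyl n \<in> carrier_mat n n" by (simp add: long_weyl_def)
  then show ?thesis
    unfolding torus_element_def
  proof (subst mat_diag_mult_left, assumption, intro eq_matI)
    fix i j assume "i < dim_row (antidiag n (ratio n D))" "j < dim_col (antidiag n (ratio n D))"
    then have ij: "i < n" "j < n" by (simp_all add: antidiag_def)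
    have "real (extend_tuple n D (n - i)) / real (extend_tuple n D (n - i - 1)) = ratio n D j"
      if "i + j = n - 1"
    proof -
      have n: "n - i = Suc j" using ij that by linarith
      show ?thesis unfolding n ratio_def by simp
    qed
    then show "mat n n (\<lambda>(i, j). real (extend_tuple n D (n - i)) /
        real (extend_tuple n D (n - i - 1)) * long_weyl n $$ (i, j)) $$ (i, j) =
        antidiag n (ratio n D) $$ (i, j)"
      unfolding long_weyl_def antidiag_def index_mat(1)[OF ij] split_conv
      by (cases "i + j = n - 1") (simp_all only: if_True if_False mult_zero_right mult.commute simp_thms)
  qed (auto simp: antidiag_def)
qed

lemma bruhat_product_eq:
  assumes "b1 \<in> carrier_mat n n" "b2 \<in> carrier_mat n n"
  shows "b1 * torus_element n D * long_weyl n * b2 = b1 * (antidiag n (ratio n D) * b2)"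
proof -
  have "torus_element n D \<in> carrier_mat n n" "long_weyl n \<in> carrier_mat n n"
    by (simp_all add: torus_element_def long_weyl_def)
  then show ?thesis using assms
    by (simp add: torus_long_weyl[symmetric] assoc_mult_mat[of _ n n _ n _ n])
qed

lemma antidiag_mult_entry:
  assumes b: "b \<in> carrier_mat n m" and ij: "l < n" "j < m"
  shows "(antidiag n f * b) $$ (n - 1 - l, j) = (-1) ^ l * f l * b $$ (l, j)"
proof -
  have "(antidiag n f * b) $$ (n - 1 - l, j)
      = (\<Sum>k<n. antidiag n f $$ (n - 1 - l, k) * b $$ (k, j))"
    using ij by (intro mult_mat_entry[OF antidiag_carrier b]) auto
  also have "\<dots> = (\<Sum>k\<in>{l}. antidiag n f $$ (n - 1 - l, k) * b $$ (k, j))"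
    using ij by (intro sum.mono_neutral_right) (auto simp: antidiag_def)
  finally show ?thesis using ij by (simp add: antidiag_def)
qed

text \<open>Summing over the row l of \<open>B\<close> pairs it with column n-1-l of
  \<open>A\<close>. Truncating this sum by triangularity yields both the corner minors and the row
  expansions of \<open>g\<close>.\<close>

lemma antidiag_product_entry:
  assumes b: "A \<in> carrier_mat m n" "B \<in> carrier_mat n k" and ij: "i < m" "j < k"
  shows "(A * (antidiag n f * B)) $$ (i, j) =
    (\<Sum>l<n. A $$ (i, n - 1 - l) * ((-1) ^ l * f l * B $$ (l, j)))"
proof -
  have "(A * (antidiag n f * B)) $$ (i, j) =
      (\<Sum>l<n. A $$ (i, l) * (antidiag n f * B) $$ (l, j))"
    by (rule mult_mat_entry[OF b(1) mult_carrier_mat[OF antidiag_carrier b(2)] ij])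
  also have "\<dots> = (\<Sum>l<n. A $$ (i, n - 1 - l) * (antidiag n f * B) $$ (n - 1 - l, j))"
    by (rule sum.reindex_bij_witness[where i = "\<lambda>l. n - 1 - l" and j = "\<lambda>l. n - 1 - l"]) auto
  also have "\<dots> = (\<Sum>l<n. A $$ (i, n - 1 - l) * ((-1) ^ l * f l * B $$ (l, j)))"
    using antidiag_mult_entry[OF b(2) _ ij(2)] by simp
  finally show ?thesis .
qed

lemma prod_ratio:
  assumes "i \<le> n" "\<And>l. l < n \<Longrightarrow> extend_tuple n D l > 0"
  shows "(\<Prod>l<i. ratio n D l) = real (extend_tuple n D i)"
  using assms
proof (induction i)
  case 0
  then show ?case by (simp add: extend_tuple_def)
next
  case (Suc i)
  then have "real (extend_tuple n D i) \<noteq> 0"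
    by (metis Suc_le_lessD of_nat_eq_0_iff less_numeral_extra(3))
  then show ?case using Suc by (simp add: ratio_def)
qed

section \<open>Corner minors of the Bruhat factorization\<close>

text \<open>Rows are counted from the bottom because the last i rows carry the corner minor D_i, to
  which Cramer's rule is applied.\<close>

definition row_span :: "nat \<Rightarrow> real mat \<Rightarrow> nat \<Rightarrow> (nat \<Rightarrow> real) \<Rightarrow> bool" where
  "row_span n g i w \<longleftrightarrow> (\<exists>x. \<forall>j<n. w j = (\<Sum>p<i. x p * g $$ (n - 1 - p, j)))"

lemma row_spanI:
  assumes "\<And>j. j < n \<Longrightarrow> w j = (\<Sum>p<i. x p * g $$ (n - 1 - p, j))"
  shows "row_span n g i w"
  using assms unfolding row_span_def by (intro exI[of _ x]) simp

lemma row_span_add: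
  assumes "row_span n g i v" "row_span n g i w"
  shows "row_span n g i (\<lambda>j. v j + w j)"
proof -
  obtain x where x: "\<forall>j<n. v j = (\<Sum>p<i. x p * g $$ (n - 1 - p, j))"
    using assms(1) unfolding row_span_def by blast
  obtain y where y: "\<forall>j<n. w j = (\<Sum>p<i. y p * g $$ (n - 1 - p, j))"
    using assms(2) unfolding row_span_def by blast
  show ?thesis
    by (rule row_spanI[where x = "\<lambda>p. x p + y p"]) (simp add: x y distrib_right sum.distrib)
qed

lemma row_span_scale:
  assumes "row_span n g i w"
  shows "row_span n g i (\<lambda>j. c * w j)"
proof -
  obtain x where x: "\<forall>j<n. w j = (\<Sum>p<i. x p * g $$ (n - 1 - p, j))"
    using assms unfolding row_span_def by blast
  show ?thesis
    by (rule row_spanI[where x = "\<lambda>p. c * x p"]) (simp add: x sum_distrib_left mult.assoc)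
qed

lemma row_span_sum:
  assumes "\<And>l. l \<in> L \<Longrightarrow> row_span n g i (w l)"
  shows "row_span n g i (\<lambda>j. \<Sum>l\<in>L. w l j)"
  using assms
proof (induction L rule: infinite_finite_induct)
  case (insert l L)
  then show ?case using row_span_add[of n g i "w l"] by simp
qed (simp_all add: row_spanI[where x = "\<lambda>_. 0"])

lemma row_span_mono:
  assumes "row_span n g i w" "i \<le> i'"
  shows "row_span n g i' w"
proof -
  obtain x where x: "\<forall>j<n. w j = (\<Sum>p<i. x p * g $$ (n - 1 - p, j))"
    using assms(1) unfolding row_span_def by blast
  show ?thesis
  proof (rule row_spanI[where x = "\<lambda>p. if p < i then x p else 0"])
    fix j assume "j < n"
    then show "w j = (\<Sum>p<i'. (if p < i then x p else 0) * g $$ (n - 1 - p, j))"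
      unfolding x[rule_format, OF \<open>j < n\<close>] using assms(2) by (intro sum.mono_neutral_cong_left) auto
  qed
qed

locale bruhat_factorization =
  fixes n :: nat and D :: "nat \<Rightarrow> nat" and b1 b2 g :: "real mat"
  assumes D_pos: "\<And>l. l \<le> n \<Longrightarrow> 0 < extend_tuple n D l"
    and b1: "b1 \<in> unipotent n" and b2: "b2 \<in> unipotent n"
    and g_eq: "g = b1 * torus_element n D * long_weyl n * b2"
begin

abbreviation E :: "nat \<Rightarrow> real" where
  "E l \<equiv> real (extend_tuple n D l)"

lemma E_nonzero: "l \<le> n \<Longrightarrow> E l \<noteq> 0"
  using D_pos[of l] by simp

lemma ratio_nonzero: "l < n \<Longrightarrow> ratio n D l \<noteq> 0"
  using E_nonzero[of l] E_nonzero[of "Suc l"] by (simp add: ratio_def)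

lemmas b1_carrier = unipotentD(1)[OF b1]
lemmas b2_carrier = unipotentD(1)[OF b2]

lemma g_eq': "g = b1 * (antidiag n (ratio n D) * b2)"
  unfolding g_eq by (rule bruhat_product_eq[OF b1_carrier b2_carrier])

lemma g_carrier: "g \<in> carrier_mat n n"
  unfolding g_eq' using b1_carrier b2_carrier
  by (intro mult_carrier_mat[where n = n] antidiag_carrier)

lemma g_entry:
  assumes "i < n" "j < n"
  shows "g $$ (i, j) = (\<Sum>l<n. b1 $$ (i, n - 1 - l) * ((-1) ^ l * ratio n D l * b2 $$ (l, j)))"
  unfolding g_eq' by (rule antidiag_product_entry[OF b1_carrier b2_carrier assms])

definition corner :: "nat \<Rightarrow> real mat" where
  "corner i = mat i i (\<lambda>(p, q). g $$ (n - i + p, q))"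

text \<open>The last i rows of \<open>b1\<close> vanish in the columns before n-i, so only the terms
  l < i survive. The corner thus factors into the lower right block of \<open>b1\<close>, a smaller
  antidiagonal matrix and the upper left block of \<open>b2\<close>, and its determinant
  telescopes.\<close>

lemma det_corner:
  assumes i: "i \<le> n"
  shows "det (corner i) = E i"
proof -
  define U where "U = mat i i (\<lambda>(p, q). b1 $$ (n - i + p, n - i + q))"
  define B where "B = mat i i (\<lambda>(p, q). b2 $$ (p, q))"
  have U: "U \<in> unipotent i" and B: "B \<in> unipotent i"
    using i unipotentD(2,3)[OF b1] unipotentD(2,3)[OF b2]
    by (auto intro!: unipotentI simp: U_def B_def)
  note c = unipotentD(1)[OF U] unipotentD(1)[OF B]
  have "corner i = U * (antidiag i (ratio n D) * B)"
  proof (rule eq_matI)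
    fix p q assume "p < dim_row (U * (antidiag i (ratio n D) * B))"
      "q < dim_col (U * (antidiag i (ratio n D) * B))"
    then have pq: "p < i" "q < i" using c by auto
    have "corner i $$ (p, q) =
        (\<Sum>l<n. b1 $$ (n - i + p, n - 1 - l) * ((-1) ^ l * ratio n D l * b2 $$ (l, q)))"
      using pq i by (simp add: corner_def g_entry)
    also have "\<dots> = (\<Sum>l<i. b1 $$ (n - i + p, n - 1 - l) * ((-1) ^ l * ratio n D l * b2 $$ (l, q)))"
      using pq i unipotentD(3)[OF b1] by (intro sum.mono_neutral_right) auto
    also have "\<dots> = (\<Sum>l<i. U $$ (p, i - 1 - l) * ((-1) ^ l * ratio n D l * B $$ (l, q)))"
    proof (rule sum.cong[OF refl])
      fix l assume "l \<in> {..<i}"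
      moreover from this i have "n - i + (i - 1 - l) = n - 1 - l" by auto
      ultimately show "b1 $$ (n - i + p, n - 1 - l) * ((-1) ^ l * ratio n D l * b2 $$ (l, q)) =
          U $$ (p, i - 1 - l) * ((-1) ^ l * ratio n D l * B $$ (l, q))"
        using pq by (simp add: U_def B_def)
    qed
    also have "\<dots> = (U * (antidiag i (ratio n D) * B)) $$ (p, q)"
      by (rule antidiag_product_entry[OF c pq, symmetric])
    finally show "corner i $$ (p, q) = (U * (antidiag i (ratio n D) * B)) $$ (p, q)" .
  qed (use c in \<open>auto simp: corner_def\<close>)
  then have "det (corner i) = det U * (det (antidiag i (ratio n D)) * det B)"
    by (simp only: det_mult[OF c(1) mult_carrier_mat[OF antidiag_carrier c(2)]]
        det_mult[OF antidiag_carrier c(2)])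
  also have "\<dots> = E i"
    using prod_ratio[OF i, of D] D_pos by (simp add: det_unipotent[OF U] det_unipotent[OF B] det_antidiag)
  finally show ?thesis .
qed

lemma det_g: "det g = 1"
proof -
  have "corner n = g" using g_carrier by (intro eq_matI) (auto simp: corner_def)
  then show ?thesis using det_corner[of n] by (simp add: extend_tuple_def)
qed

text \<open>Cramer's rule for the bottom left corner of \<open>g\<close>, whose determinant is \<open>D\<^sub>i\<close>.\<close>

lemma row_span_integral:
  assumes i: "i \<le> n" and S: "real_subring S" and gS: "elements_mat g \<subseteq> S"
    and w: "row_span n g i w" and wS: "\<And>j. j < i \<Longrightarrow> w j \<in> S" and j: "j < n"
  shows "E i * w j \<in> S"
proof -
  obtain x where x: "\<And>j. j < n \<Longrightarrow> w j = (\<Sum>p<i. x p * g $$ (n - 1 - p, j))"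
    using w unfolding row_span_def by blast
  note gS' = gS[unfolded elements_mat_subset_iff[OF g_carrier], rule_format]
  \<comment> \<open>Row q of \<open>corner i\<close> is row n-i+q of \<open>g\<close>, so the
    coefficients, counted from the bottom, enter in reverse order. Multiplying
    \<open>X * corner i\<close> by the adjugate gives \<open>E i\<close> times \<open>X\<close>,
    which shows that \<open>E i\<close> clears the denominators of the coefficients.\<close>
  define X where "X = mat 1 i (\<lambda>(r, q). x (i - 1 - q))"
  have G: "corner i \<in> carrier_mat i i" and X: "X \<in> carrier_mat 1 i"
    by (simp_all add: corner_def X_def)
  have GS: "elements_mat (corner i) \<subseteq> S"
    unfolding elements_mat_subset_iff[OF G] using gS' i by (simp add: corner_def)
  have "(X * corner i) $$ (0, j) = w j" if "j < i" for j
  proof -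
    have "(X * corner i) $$ (0, j) = (\<Sum>q<i. X $$ (0, q) * corner i $$ (q, j))"
      by (rule mult_mat_entry[OF X G _ that]) simp
    also have "\<dots> = (\<Sum>p<i. x p * g $$ (n - 1 - p, j))"
      using that i
      by (intro sum.reindex_bij_witness[where i = "\<lambda>l. i - 1 - l" and j = "\<lambda>l. i - 1 - l"])
        (auto simp: X_def corner_def)
    finally show ?thesis using x that i by simp
  qed
  then have "elements_mat (X * corner i) \<subseteq> S"
    using wS elements_mat_subset_iff[OF mult_carrier_mat[OF X G]] by simp
  then have "elements_mat (X * corner i * adj_mat (corner i)) \<subseteq> S"
    by (rule elements_mat_mult[OF S mult_carrier_mat[OF X G] adj_mat(1)[OF G] _
          adj_mat_in_subring[OF S G GS]])
  moreover have "X * corner i * adj_mat (corner i) = E i \<cdot>\<^sub>m X"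
    by (simp only: assoc_mult_mat[OF X G adj_mat(1)[OF G]] adj_mat(2)[OF G] det_corner[OF i]
        mult_smult_distrib[OF X one_carrier_mat] right_mult_one_mat[OF X])
  ultimately have "elements_mat (E i \<cdot>\<^sub>m X) \<subseteq> S" by simp
  then have *: "\<forall>q<i. E i * x (i - 1 - q) \<in> S"
    using elements_mat_subset_iff[of "E i \<cdot>\<^sub>m X" 1 i S] X by (simp add: X_def)
  have "E i * x p \<in> S" if "p < i" for p
    using *[rule_format, of "i - 1 - p"] that by simp
  then have "(\<Sum>p<i. (E i * x p) * g $$ (n - 1 - p, j)) \<in> S"
    using i j gS' by (intro real_subring_sum[OF S], intro real_subring_closed(6)[OF S, of "E i * x _"]) auto
  also have "(\<Sum>p<i. (E i * x p) * g $$ (n - 1 - p, j)) = E i * w j"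
    using x[OF j] by (simp add: sum_distrib_left mult.assoc)
  finally show ?thesis .
qed

text \<open>With c the inverse of \<open>b1\<close>, row n-1-l of \<open>c * g\<close> is a nonzero
  multiple of row l of \<open>b2\<close>. Since c is upper triangular, only the last l+1 rows of
  \<open>g\<close> enter.\<close>

lemma row_span_b2:
  assumes l: "l < n"
  shows "row_span n g (Suc l) (\<lambda>j. b2 $$ (l, j))"
proof -
  obtain c where c: "c \<in> unipotent n" "c * b1 = 1\<^sub>m n"
    using unipotent_inverse[OF real_subring_UNIV b1] by auto
  note cc = unipotentD(1)[OF c(1)]
  have ab: "antidiag n (ratio n D) * b2 \<in> carrier_mat n n"
    by (rule mult_carrier_mat[OF antidiag_carrier b2_carrier])
  have cg: "c * g = antidiag n (ratio n D) * b2"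
    unfolding g_eq'
    by (simp only: assoc_mult_mat[OF cc b1_carrier ab, symmetric] c(2) left_mult_one_mat[OF ab])
  let ?r = "(-1) ^ l * ratio n D l"
  have "b2 $$ (l, j) = (\<Sum>p<Suc l. c $$ (n - 1 - l, n - 1 - p) / ?r * g $$ (n - 1 - p, j))"
    if j: "j < n" for j
  proof -
    have "?r * b2 $$ (l, j) = (c * g) $$ (n - 1 - l, j)"
      unfolding cg by (rule antidiag_mult_entry[OF b2_carrier l j, symmetric])
    also have "\<dots> = (\<Sum>m<n. c $$ (n - 1 - l, m) * g $$ (m, j))"
      using l j by (intro mult_mat_entry[OF cc g_carrier]) auto
    also have "\<dots> = (\<Sum>p<n. c $$ (n - 1 - l, n - 1 - p) * g $$ (n - 1 - p, j))"
      by (rule sum.reindex_bij_witness[where i = "\<lambda>l. n - 1 - l" and j = "\<lambda>l. n - 1 - l"]) auto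
    also have "\<dots> = (\<Sum>p<Suc l. c $$ (n - 1 - l, n - 1 - p) * g $$ (n - 1 - p, j))"
      using l unipotentD(3)[OF c(1)] by (intro sum.mono_neutral_right) auto
    finally have "?r * b2 $$ (l, j) / ?r =
        (\<Sum>p<Suc l. c $$ (n - 1 - l, n - 1 - p) * g $$ (n - 1 - p, j)) / ?r" by simp
    then show ?thesis
      using ratio_nonzero[OF l] by (simp add: sum_divide_distrib del: sum.lessThan_Suc)
  qed
  then show ?thesis by (rule row_spanI)
qed

text \<open>The first l+1 entries of the row are zeros followed by 1, so Cramer's rule with the
  minor of size l+1 controls the denominators of the whole row.\<close>

lemma b2_row_integral:
  assumes S: "real_subring S" and gS: "elements_mat g \<subseteq> S" and l: "l < n" and j: "j < n"
  shows "E (Suc l) * b2 $$ (l, j) \<in> S"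
proof (rule row_span_integral[OF _ S gS row_span_b2[OF l] _ j])
  show "b2 $$ (l, j') \<in> S" if "j' < Suc l" for j'
    using that l unipotentD(2,3)[OF b2] real_subring_closed(1,2)[OF S] by (cases "j' = l") auto
qed (use l in simp)

text \<open>Subtracting a multiple of row l+1 clears column l+1, so the first l+2 entries lie in
  \<open>S\<close> and the next minor becomes the denominator. This handles primes dividing
  \<open>E (Suc l)\<close>, which for coprime moduli do not divide
  \<open>E (Suc (Suc l))\<close>.\<close>

lemma b2_reduced_row_integral:
  assumes S: "real_subring S" and gS: "elements_mat g \<subseteq> S" and l: "Suc l < n" and j: "j < n"
  shows "E (Suc (Suc l)) * (b2 $$ (l, j) - b2 $$ (l, Suc l) * b2 $$ (Suc l, j)) \<in> S"
proof (rule row_span_integral[OF _ S gS _ _ j])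
  have "row_span n g (Suc (Suc l)) (\<lambda>j. b2 $$ (l, j) + (- b2 $$ (l, Suc l)) * b2 $$ (Suc l, j))"
    using l by (intro row_span_add row_span_scale row_span_b2 row_span_mono[OF row_span_b2]) auto
  then show "row_span n g (Suc (Suc l)) (\<lambda>j. b2 $$ (l, j) - b2 $$ (l, Suc l) * b2 $$ (Suc l, j))"
    by simp
  show "b2 $$ (l, j') - b2 $$ (l, Suc l) * b2 $$ (Suc l, j') \<in> S" if "j' < Suc (Suc l)" for j'
    using that l unipotentD(2,3)[OF b2] real_subring_closed(1,2)[OF S]
    by (cases "j' = Suc l"; cases "j' = l") auto
qed (use l in simp)

text \<open>A row of \<open>g\<close> splits into a part z from the rows l < k of \<open>b2\<close>
  and a part w from rows k and k+1. In the first k columns w vanishes, so z is integral there;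
  Cramer's rule makes \<open>E k\<close> times z, hence \<open>E k\<close> times w, integral in
  every column. Column k of w yields \<alpha>, and column k+1 yields the congruence.\<close>

lemma superdiagonal_congruence:
  assumes gZ: "elements_mat g \<subseteq> \<int>" and k: "Suc k < n"
  defines "\<alpha> \<equiv> E (Suc k) * b1 $$ (n - 1 - Suc k, n - 1 - k)"
    and "\<beta> \<equiv> E (Suc k) * b2 $$ (k, Suc k)"
  shows "\<alpha> \<in> \<int>" "\<beta> \<in> \<int>" "(\<alpha> * \<beta> - E k * E (Suc (Suc k))) / E (Suc k) \<in> \<int>"
proof -
  let ?s = "b1 $$ (n - 1 - Suc k, n - 1 - k)"
  let ?q = "\<lambda>l. (-1) ^ l * ratio n D l"
  define w where "w j = ?s * (?q k * b2 $$ (k, j)) + ?q (Suc k) * b2 $$ (Suc k, j)" for j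
  let ?z = "\<lambda>j. \<Sum>l<k. b1 $$ (n - 1 - Suc k, n - 1 - l) * (?q l * b2 $$ (l, j))"
  have g_row: "g $$ (n - 1 - Suc k, j) = ?z j + w j" if j: "j < n" for j
  proof -
    have "g $$ (n - 1 - Suc k, j) =
        (\<Sum>l<n. b1 $$ (n - 1 - Suc k, n - 1 - l) * (?q l * b2 $$ (l, j)))"
      using k j by (intro g_entry) auto
    also have "\<dots> = (\<Sum>l<Suc (Suc k). b1 $$ (n - 1 - Suc k, n - 1 - l) * (?q l * b2 $$ (l, j)))"
      using k unipotentD(3)[OF b1] by (intro sum.mono_neutral_right) auto
    also have "\<dots> = ?z j + w j"
      using k unipotentD(2)[OF b1, of "n - 1 - Suc k"] by (simp add: w_def)
    finally show ?thesis .
  qed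
  have gZ': "g $$ (i, j) \<in> \<int>" if "i < n" "j < n" for i j
    using gZ that unfolding elements_mat_subset_iff[OF g_carrier] by blast
  have w0: "w j = 0" if "j < k" for j
    using that k unipotentD(3)[OF b2] by (simp add: w_def)
  have "row_span n g k ?z"
    using k
    by (intro row_span_sum row_span_scale row_span_mono[OF row_span_b2]) auto
  moreover have "?z j \<in> \<int>" if "j < k" for j
    using g_row[of j] w0[OF that] gZ'[of "n - 1 - Suc k" j] k that by simp
  ultimately have Ez: "E k * ?z j \<in> \<int>" if "j < n" for j
    using k that by (intro row_span_integral[where w = ?z, OF _ real_subring_Ints gZ]) simp_all
  have Ew: "E k * w j \<in> \<int>" if "j < n" for j
  proof -
    have "E k * w j = E k * g $$ (n - 1 - Suc k, j) - E k * ?z j"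
      using g_row[OF that] by (simp add: algebra_simps)
    also have "\<dots> \<in> \<int>"
      using k that by (intro Ints_diff[OF Ints_mult[OF Ints_of_nat gZ'] Ez]) auto
    finally show ?thesis .
  qed
  have sgn: "(-1) ^ k * x \<in> \<int> \<Longrightarrow> x \<in> \<int>" for x :: real
    by (cases "even k") simp_all
  have "E k * w k = (-1) ^ k * \<alpha>"
    using k unipotentD(2,3)[OF b2] E_nonzero[of k]
    by (simp add: w_def \<alpha>_def ratio_def)
  then show "\<alpha> \<in> \<int>" using Ew[of k] k by (metis sgn Suc_lessD)
  show "\<beta> \<in> \<int>"
    unfolding \<beta>_def using k by (intro b2_row_integral[OF real_subring_Ints gZ]) auto
  have "E k * w (Suc k) = (-1) ^ k * ((\<alpha> * \<beta> - E k * E (Suc (Suc k))) / E (Suc k))"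
    using k unipotentD(2)[OF b2] E_nonzero[of k] E_nonzero[of "Suc k"]
    by (simp add: w_def \<alpha>_def \<beta>_def ratio_def field_simps)
  then show "(\<alpha> * \<beta> - E k * E (Suc (Suc k))) / E (Suc k) \<in> \<int>"
    using Ew[of "Suc k"] k by (metis sgn)
qed

end

section \<open>Uniqueness of the Bruhat factorization\<close>

lemma bruhat_factorization_unique:
  assumes "bruhat_factorization n D b1 b2 g" "bruhat_factorization n D c1 c2 g"
  shows "b1 = c1" "b2 = c2"
proof -
  interpret b: bruhat_factorization n D b1 b2 g by fact
  interpret c: bruhat_factorization n D c1 c2 g by fact
  let ?W = "antidiag n (ratio n D)"
  obtain b1' where b1': "b1' \<in> unipotent n" "b1' * b1 = 1\<^sub>m n" "b1 * b1' = 1\<^sub>m n"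
    using unipotent_inverse[OF real_subring_UNIV b.b1] by auto
  obtain c2' where c2': "c2' \<in> unipotent n" "c2' * c2 = 1\<^sub>m n" "c2 * c2' = 1\<^sub>m n"
    using unipotent_inverse[OF real_subring_UNIV c.b2] by auto
  define u where "u = b1' * c1"
  define v where "v = b2 * c2'"
  have u: "u \<in> unipotent n" and v: "v \<in> unipotent n"
    unfolding u_def v_def by (intro unipotent_mult b1' c2' c.b1 b.b2)+
  note carr = unipotentD(1)[OF b1'(1)] unipotentD(1)[OF c2'(1)] b.b1_carrier b.b2_carrier
    c.b1_carrier c.b2_carrier unipotentD(1)[OF u] unipotentD(1)[OF v] antidiag_carrier[of n "ratio n D"]
  note assoc = assoc_mult_mat[of _ n n _ n _ n]
  have cancel: "x * (y * z) = z"
    if "x * y = 1\<^sub>m n" "x \<in> carrier_mat n n" "y \<in> carrier_mat n n" "z \<in> carrier_mat n n"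
    for x y z :: "real mat"
    using that by (simp add: assoc[symmetric])
  have eq: "b1 * (?W * b2) = c1 * (?W * c2)"
    using b.g_eq' c.g_eq' by simp
  have "?W * v = ?W * b2 * c2'"
    unfolding v_def using carr by (simp add: assoc)
  also have "?W * b2 = b1' * (b1 * (?W * b2))"
    using carr by (intro cancel[OF b1'(2), symmetric] mult_carrier_mat[where n = n])
  also have "\<dots> * c2' = u * ?W"
    using carr c2'(3) unfolding u_def eq by (simp add: assoc)
  finally have Wv: "?W * v = u * ?W" .
  \<comment> \<open>Conjugation by the antidiagonal matrix reverses rows and columns: entries of u
    above the diagonal correspond, up to nonzero factors, to entries of v below it, and these
    vanish. Thus u = 1, and then v = 1.\<close>
  have entries: "u $$ (n - 1 - l, n - 1 - j) * ((-1) ^ j * ratio n D j) =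
      (-1) ^ l * ratio n D l * v $$ (l, j)" if "l < n" "j < n" for l j
  proof -
    have "(u * ?W) $$ (n - 1 - l, j) = (\<Sum>k<n. u $$ (n - 1 - l, k) * ?W $$ (k, j))"
      using that carr by (intro mult_mat_entry[where m = n]) auto
    also have "\<dots> = (\<Sum>k\<in>{n - 1 - j}. u $$ (n - 1 - l, k) * ?W $$ (k, j))"
      using that by (intro sum.mono_neutral_right) (auto simp: antidiag_def)
    finally have "(u * ?W) $$ (n - 1 - l, j) = u $$ (n - 1 - l, n - 1 - j) * ((-1) ^ j * ratio n D j)"
      using that by (simp add: antidiag_def)
    then show ?thesis
      unfolding Wv[symmetric] antidiag_mult_entry[OF unipotentD(1)[OF v] that] by (rule sym)
  qed
  have "u = 1\<^sub>m n"
  proof (rule eq_matI)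
    fix i j assume "i < dim_row (1\<^sub>m n :: real mat)" "j < dim_col (1\<^sub>m n :: real mat)"
    then have ij: "i < n" "j < n" by auto
    consider "i < j" | "i = j" | "j < i" by linarith
    then show "u $$ (i, j) = 1\<^sub>m n $$ (i, j)"
    proof cases
      case 1
      have "v $$ (n - 1 - i, n - 1 - j) = 0"
        using 1 ij unipotentD(3)[OF v] by simp
      then show ?thesis
        using entries[of "n - 1 - i" "n - 1 - j"] ij 1 b.ratio_nonzero by simp
    qed (use ij unipotentD(2,3)[OF u] in auto)
  qed (use carr in auto)
  then have "b1 * u = b1" using carr by simp
  moreover have "b1 * u = c1"
    unfolding u_def using carr by (intro cancel[OF b1'(3)])
  ultimately show "b1 = c1" by simp
  have "v = 1\<^sub>m n"
  proof (rule eq_matI)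
    fix i j assume "i < dim_row (1\<^sub>m n :: real mat)" "j < dim_col (1\<^sub>m n :: real mat)"
    then have ij: "i < n" "j < n" by auto
    consider "i < j" | "i = j" | "j < i" by linarith
    then show "v $$ (i, j) = 1\<^sub>m n $$ (i, j)"
    proof cases
      case 1
      then have "n - 1 - i \<noteq> n - 1 - j" using ij by linarith
      then show ?thesis
        using entries[of i j] ij 1 b.ratio_nonzero \<open>u = 1\<^sub>m n\<close> by simp
    qed (use ij unipotentD(2,3)[OF v] in auto)
  qed (use carr in auto)
  then have "v * c2 = c2" using carr by simp
  moreover have "v * c2 = b2"
    unfolding v_def using carr c2'(2) by (simp add: assoc)
  ultimately show "b2 = c2" by simp
qed

text \<open>Uniqueness gives the descriptions by \<open>THE\<close> their meaning: any factorization
  that is exhibited computes \<open>mu\<close> and \<open>mu'\<close>.\<close>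

lemma bruhat_factorization_mu:
  assumes "bruhat_factorization n D b1 b2 g"
  shows "mu n D g = b1" "mu' n D g = b2"
proof -
  interpret bruhat_factorization n D b1 b2 g by fact
  have fact: "bruhat_factorization n D c1 c2 g"
    if "c1 \<in> unipotent n" "c2 \<in> unipotent n" "g = c1 * torus_element n D * long_weyl n * c2" for c1 c2
    using that D_pos by unfold_locales
  show "mu n D g = b1" unfolding mu_def
  proof (rule the_equality)
    show "b1 \<in> unipotent n \<and>
        (\<exists>b2\<in>unipotent n. g = b1 * torus_element n D * long_weyl n * b2)"
      using b1 b2 g_eq by (intro conjI bexI[of _ b2])
    fix c1 assume c1: "c1 \<in> unipotent n \<and>
        (\<exists>b2\<in>unipotent n. g = c1 * torus_element n D * long_weyl n * b2)"
    then obtain c2 where c2: "c2 \<in> unipotent n" "g = c1 * torus_element n D * long_weyl n * c2"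
      by (elim conjE bexE)
    show "c1 = b1"
      by (rule bruhat_factorization_unique(1)[OF fact[OF conjunct1[OF c1] c2] assms])
  qed
  show "mu' n D g = b2" unfolding mu'_def
  proof (rule the_equality)
    show "b2 \<in> unipotent n \<and>
        (\<exists>b1\<in>unipotent n. g = b1 * torus_element n D * long_weyl n * b2)"
      using b1 b2 g_eq by (intro conjI bexI[of _ b1])
    fix c2 assume c2: "c2 \<in> unipotent n \<and>
        (\<exists>b1\<in>unipotent n. g = b1 * torus_element n D * long_weyl n * c2)"
    then obtain c1 where c1: "c1 \<in> unipotent n" "g = c1 * torus_element n D * long_weyl n * c2"
      by (elim conjE bexE)
    show "c2 = b2"
      by (rule bruhat_factorization_unique(2)[OF fact[OF c1(1) conjunct1[OF c2] c1(2)] assms])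
  qed
qed

lemma bruhat_cell_iff:
  assumes "\<And>l. l \<le> n \<Longrightarrow> 0 < extend_tuple n D l"
  shows "g \<in> bruhat_cell n D \<longleftrightarrow>
    elements_mat g \<subseteq> \<int> \<and> bruhat_factorization n D (mu n D g) (mu' n D g) g"
proof
  assume g: "g \<in> bruhat_cell n D"
  then obtain b1 b2 where "b1 \<in> unipotent n" "b2 \<in> unipotent n"
    "g = b1 * torus_element n D * long_weyl n * b2"
    unfolding bruhat_cell_def by blast
  then have f: "bruhat_factorization n D b1 b2 g" using assms by unfold_locales
  show "elements_mat g \<subseteq> \<int> \<and> bruhat_factorization n D (mu n D g) (mu' n D g) g"
    using f g bruhat_factorization_mu[OF f] by (simp add: bruhat_cell_def SL_int_def)
next
  assume *: "elements_mat g \<subseteq> \<int> \<and> bruhat_factorization n D (mu n D g) (mu' n D g) g"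
  then interpret bruhat_factorization n D "mu n D g" "mu' n D g" g by simp
  show "g \<in> bruhat_cell n D"
    unfolding bruhat_cell_def SL_int_def using * b1 b2 g_eq g_carrier det_g by blast
qed

section \<open>The double coset relation for coprime moduli\<close>

text \<open>For prime p, the localization of \<int> at p inside \<real>. As p divides 0, the
  multiplier m is nonzero, so every member is rational.\<close>

definition localization :: "nat \<Rightarrow> real set" where
  "localization p = {x. \<exists>m :: nat. \<not> p dvd m \<and> real m * x \<in> \<int>}"

lemma localizationI: "\<not> p dvd m \<Longrightarrow> real m * x \<in> \<int> \<Longrightarrow> x \<in> localization p"
  unfolding localization_def by blast

lemma real_subring_localization:
  assumes "prime p" shows "real_subring (localization p)"
  unfolding real_subring_def
proof (intro conjI ballI)
  have "\<not> p dvd 1" using assms by auto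
  then show "1 \<in> localization p" by (rule localizationI) simp
  fix x y assume "x \<in> localization p" "y \<in> localization p"
  then obtain k m :: nat where km: "\<not> p dvd k" "real k * x \<in> \<int>" "\<not> p dvd m" "real m * y \<in> \<int>"
    unfolding localization_def by blast
  have ndvd: "\<not> p dvd k * m" using assms km by (simp add: prime_dvd_mult_iff)
  have "real (k * m) * (x - y) = real m * (real k * x) - real k * (real m * y)"
    by (simp add: algebra_simps)
  also have "\<dots> \<in> \<int>"
    by (rule Ints_diff[OF Ints_mult[OF Ints_of_nat km(2)] Ints_mult[OF Ints_of_nat km(4)]])
  finally show "x - y \<in> localization p" by (rule localizationI[OF ndvd])
  have "real (k * m) * (x * y) = (real k * x) * (real m * y)" by (simp add: algebra_simps)
  also have "\<dots> \<in> \<int>" by (rule Ints_mult[OF km(2,4)])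
  finally show "x * y \<in> localization p" by (rule localizationI[OF ndvd])
qed

text \<open>The least positive denominator m0 of x has no prime divisor p: there is a denominator m
  prime to p, by Bezout the gcd of m0 and m is a denominator too, and minimality makes m0 divide
  m.\<close>

lemma Ints_eq_Inter_localization:
  assumes "\<And>p. prime p \<Longrightarrow> x \<in> localization p"
  shows "x \<in> \<int>"
proof -
  define P where "P m \<longleftrightarrow> m > 0 \<and> real m * x \<in> \<int>" for m :: nat
  \<comment> \<open>Any single prime supplies a positive denominator, so a least one exists.\<close>
  have "x \<in> localization 2" by (rule assms) simp
  then obtain m1 :: nat where "\<not> 2 dvd m1" "real m1 * x \<in> \<int>"
    unfolding localization_def by blast
  then have P1: "P m1" unfolding P_def by (auto intro: gr0I)
  define m0 where "m0 = (LEAST m. P m)"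
  have m0: "P m0" unfolding m0_def by (rule LeastI[of P, OF P1])
  have "m0 = 1"
  proof (rule ccontr)
    assume "m0 \<noteq> 1"
    then obtain p where p: "prime p" "p dvd m0" using prime_factor_nat by blast
    obtain m :: nat where m: "\<not> p dvd m" "real m * x \<in> \<int>"
      using assms[OF p(1)] unfolding localization_def by blast
    obtain a b where ab: "a * int m0 + b * int m = gcd (int m0) (int m)"
      using bezout_int by blast
    have "real (gcd m0 m) = of_int (gcd (int m0) (int m))" by simp
    also have "\<dots> = of_int a * real m0 + of_int b * real m" unfolding ab[symmetric] by simp
    finally have "real (gcd m0 m) * x = of_int a * (real m0 * x) + of_int b * (real m * x)"
      by (simp add: algebra_simps)
    also have "\<dots> \<in> \<int>"
      using m0 m(2) unfolding P_def by (intro Ints_add Ints_mult[of "of_int _"]) auto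
    finally have "P (gcd m0 m)" using m0 unfolding P_def by simp
    then have "m0 \<le> gcd m0 m" unfolding m0_def by (rule Least_le)
    moreover have "gcd m0 m \<le> m0" using m0 unfolding P_def by (intro gcd_le1_nat) simp
    ultimately have "m0 dvd m" by (metis gcd_dvd2 le_antisym)
    then show False using p(2) m(1) dvd_trans by blast
  qed
  then show ?thesis using m0 unfolding P_def by simp
qed

lemma extend_tuple_coprime:
  assumes "pairwise (\<lambda>i j. coprime (D i) (D j)) {1..n-1}" "i \<noteq> j" "i \<le> n" "j \<le> n"
  shows "coprime (extend_tuple n D i) (extend_tuple n D j)"
  using assms unfolding extend_tuple_def pairwise_def by auto

text \<open>One row operation A makes \<open>b2\<close> p-integral by clearing the superdiagonal
  entry at the exceptional index. The same A makes \<open>c2\<close> p-integral, as the two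
  superdiagonals agree modulo \<int>. Then v is the inverse of \<open>A * b2\<close> times
  \<open>A * c2\<close>.\<close>

lemma localization_integral_transition:
  assumes f: "bruhat_factorization n D b1 b2 g" "bruhat_factorization n D c1 c2 h"
    and gh: "elements_mat g \<subseteq> \<int>" "elements_mat h \<subseteq> \<int>" and n: "2 \<le> n"
    and cop: "pairwise (\<lambda>i j. coprime (D i) (D j)) {1..n-1}"
    and cong: "\<And>k. Suc k < n \<Longrightarrow> c2 $$ (k, Suc k) - b2 $$ (k, Suc k) \<in> \<int>"
    and v: "v \<in> carrier_mat n n" "b2 * v = c2" and p: "prime p"
  shows "elements_mat v \<subseteq> localization p"
proof -
  interpret b: bruhat_factorization n D b1 b2 g by fact
  interpret c: bruhat_factorization n D c1 c2 h by fact
  let ?R = "localization p"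
  note R = real_subring_localization[OF p]
  \<comment> \<open>At most one of the moduli fails to be a unit at \<open>p\<close>.\<close>
  obtain k where k: "Suc k < n"
    and kp: "\<And>l. l < n \<Longrightarrow> l \<noteq> k \<Longrightarrow> \<not> p dvd extend_tuple n D (Suc l)"
  proof (cases "\<exists>k. k < n \<and> p dvd extend_tuple n D (Suc k)")
    case True
    then obtain k where k: "k < n" "p dvd extend_tuple n D (Suc k)" by blast
    \<comment> \<open>By convention the modulus with index n is 1, which p does not divide; so row
      k+1 exists.\<close>
    have "Suc k \<noteq> n" using k p by (auto simp: extend_tuple_def)
    moreover have "\<not> p dvd extend_tuple n D (Suc l)" if "l < n" "l \<noteq> k" for l
    proof
      assume l: "p dvd extend_tuple n D (Suc l)"
      have "coprime (extend_tuple n D (Suc k)) (extend_tuple n D (Suc l))"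
        using k that by (intro extend_tuple_coprime[OF cop]) auto
      then have "p dvd 1" by (rule coprime_common_divisor[OF _ k(2) l])
      then show False using p by simp
    qed
    ultimately show ?thesis using that[of k] k by auto
  next
    case False
    \<comment> \<open>Without an exceptional index, 0 serves as a placeholder;
      \<open>2 \<le> n\<close> makes it admissible.\<close>
    then show ?thesis using that[of 0] n by auto
  qed
  let ?t = "b2 $$ (k, Suc k)"
  define A where "A = addrow_mat n (- ?t) k (Suc k)"
  have A: "A \<in> carrier_mat n n" by (simp add: A_def)
  have Ax: "(A * x) $$ (i, j) = (if i = k then x $$ (i, j) - ?t * x $$ (Suc k, j) else x $$ (i, j))"
    if "x \<in> carrier_mat n n" "i < n" "j < n" for x i j
    unfolding A_def addrow_mat[OF that(1) k, symmetric] using that by auto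
  have row: "x $$ (i, j) \<in> ?R"
    if x: "bruhat_factorization n D y x w" and w: "elements_mat w \<subseteq> \<int>"
      and ij: "i < n" "j < n" "i \<noteq> k" for x y w i j
    by (rule localizationI[OF kp[OF ij(1,3)]
          bruhat_factorization.b2_row_integral[OF x real_subring_Ints w ij(1,2)]])
  have row_k: "x $$ (k, j) - x $$ (k, Suc k) * x $$ (Suc k, j) \<in> ?R"
    if x: "bruhat_factorization n D y x w" and w: "elements_mat w \<subseteq> \<int>" and j: "j < n" for x y w j
    using k by (intro localizationI[OF kp[of "Suc k"]
          bruhat_factorization.b2_reduced_row_integral[OF x real_subring_Ints w k j]]) auto
  have Ab: "A * b2 \<in> unipotent n"
  proof (rule unipotentI)
    show "A * b2 \<in> carrier_mat n n" by (rule mult_carrier_mat[OF A b.b2_carrier])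
  qed (use k unipotentD(2,3)[OF b.b2] in \<open>auto simp: Ax[OF b.b2_carrier] simp del: index_mult_mat\<close>)
  have AbR: "elements_mat (A * b2) \<subseteq> ?R"
    unfolding elements_mat_subset_iff[OF unipotentD(1)[OF Ab]]
    using row[OF f(1) gh(1)] row_k[OF f(1) gh(1)] by (simp add: Ax[OF b.b2_carrier] del: index_mult_mat)
  have Ac: "A * c2 \<in> carrier_mat n n" by (rule mult_carrier_mat[OF A c.b2_carrier])
  \<comment> \<open>The multiplier comes from \<open>b2\<close>, not from \<open>c2\<close>; by
    \<open>cong\<close> the discrepancy is an integer multiple of a p-integral row.\<close>
  have "c2 $$ (k, j) - ?t * c2 $$ (Suc k, j) \<in> ?R" if j: "j < n" for j
  proof -
    have "c2 $$ (k, j) - ?t * c2 $$ (Suc k, j) =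
        (c2 $$ (k, j) - c2 $$ (k, Suc k) * c2 $$ (Suc k, j)) +
        (c2 $$ (k, Suc k) - ?t) * c2 $$ (Suc k, j)"
      by (simp add: algebra_simps)
    also have "\<dots> \<in> ?R"
      using row_k[OF f(2) gh(2) j] row[OF f(2) gh(2) k j] cong[OF k] real_subring_Ints_subset[OF R]
      by (intro real_subring_closed(4)[OF R] real_subring_closed(6)[OF R]) auto
    finally show ?thesis .
  qed
  then have AcR: "elements_mat (A * c2) \<subseteq> ?R"
    unfolding elements_mat_subset_iff[OF Ac]
    using row[OF f(2) gh(2)] by (simp add: Ax[OF c.b2_carrier] del: index_mult_mat)
  obtain y where y: "y \<in> unipotent n" "elements_mat y \<subseteq> ?R" "y * (A * b2) = 1\<^sub>m n"
    by (rule unipotent_inverse[OF R Ab AbR])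
  note yc = unipotentD(1)[OF y(1)]
  have "y * (A * c2) = y * (A * b2) * v"
    using yc A b.b2_carrier v by (simp add: assoc_mult_mat[of _ n n _ n _ n])
  also have "\<dots> = v" unfolding y(3) by (rule left_mult_one_mat[OF v(1)])
  finally show ?thesis
    using elements_mat_mult[OF R yc Ac y(2) AcR] by simp
qed

lemma unipotent_mult_superdiagonal:
  assumes "u \<in> unipotent n" "v \<in> unipotent n" "Suc i < n"
  shows "(u * v) $$ (i, Suc i) = u $$ (i, Suc i) + v $$ (i, Suc i)"
proof -
  note v = unipotentD[OF assms(2)]
  have "(\<Sum>l\<in>{i<..<n}. u $$ (i, l) * v $$ (l, Suc i)) =
      (\<Sum>l\<in>{Suc i}. u $$ (i, l) * v $$ (l, Suc i))"
    using assms(3) v(3) by (intro sum.mono_neutral_right) auto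
  then show ?thesis
    using assms v(2) by (subst unipotent_mult_entry[OF assms(1) v(1)]) auto
qed

lemma unipotent_int_iff: "u \<in> unipotent_int n \<longleftrightarrow> u \<in> unipotent n \<and> elements_mat u \<subseteq> \<int>"
  by (simp add: unipotent_int_def)

text \<open>Forwards, u and v multiply \<open>mu\<close> on the left and \<open>mu'\<close> on the
  right, and superdiagonal entries of unipotent matrices add. Backwards, the transition v between
  the two \<open>mu'\<close> is integral at every prime, hence integral; then u is \<open>h\<close>
  times the inverse of \<open>g * v\<close>, which is integral because \<open>g * v\<close> has
  determinant 1.\<close>

lemma double_coset_rel_iff:
  assumes pos: "\<And>l. l \<le> n \<Longrightarrow> 0 < extend_tuple n D l" and n: "2 \<le> n"
    and cop: "pairwise (\<lambda>i j. coprime (D i) (D j)) {1..n-1}"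
    and g: "g \<in> bruhat_cell n D" and h: "h \<in> bruhat_cell n D"
  shows "(g, h) \<in> double_coset_rel n D \<longleftrightarrow>
    (\<forall>k. Suc k < n \<longrightarrow> mu n D h $$ (n - 1 - Suc k, n - 1 - k) - mu n D g $$ (n - 1 - Suc k, n - 1 - k) \<in> \<int>
      \<and> mu' n D h $$ (k, Suc k) - mu' n D g $$ (k, Suc k) \<in> \<int>)"
proof
  have cell: "x \<in> bruhat_cell n D \<longleftrightarrow>
    elements_mat x \<subseteq> \<int> \<and> bruhat_factorization n D (mu n D x) (mu' n D x) x" for x
    using pos by (rule bruhat_cell_iff)
  note gf = g[unfolded cell] and hf = h[unfolded cell]
  interpret g: bruhat_factorization n D "mu n D g" "mu' n D g" g using gf by simp
  interpret h: bruhat_factorization n D "mu n D h" "mu' n D h" h using hf by simp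
  let ?b1 = "mu n D g" and ?b2 = "mu' n D g" and ?c1 = "mu n D h" and ?c2 = "mu' n D h"
  let ?W = "antidiag n (ratio n D)"
  note assoc = assoc_mult_mat[of _ n n _ n _ n]
  note carr = g.b1_carrier g.b2_carrier h.b1_carrier h.b2_carrier antidiag_carrier[of n "ratio n D"]
    g.g_carrier h.g_carrier
  {
    assume "(g, h) \<in> double_coset_rel n D"
    then obtain u v where "u \<in> unipotent_int n" "v \<in> unipotent_int n" "h = u * g * v"
      unfolding double_coset_rel_def by auto
    then have uv: "u \<in> unipotent n" "elements_mat u \<subseteq> \<int>" "v \<in> unipotent n"
        "elements_mat v \<subseteq> \<int>" "h = u * g * v"
      by (simp_all add: unipotent_int_iff)
    note c = unipotentD(1)[OF uv(1)] unipotentD(1)[OF uv(3)]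
    have ub: "u * ?b1 \<in> unipotent n" "?b2 * v \<in> unipotent n"
      using uv g.b1 g.b2 by (simp_all add: unipotent_mult)
    have "h = u * ?b1 * (?W * (?b2 * v))"
      unfolding uv(5) by (subst g.g_eq') (use carr c in \<open>simp add: assoc\<close>)
    also have "\<dots> = u * ?b1 * torus_element n D * long_weyl n * (?b2 * v)"
      by (rule bruhat_product_eq[OF unipotentD(1)[OF ub(1)] unipotentD(1)[OF ub(2)], symmetric])
    finally have "bruhat_factorization n D (u * ?b1) (?b2 * v) h"
      using ub pos by unfold_locales
    then have mu: "?c1 = u * ?b1" "?c2 = ?b2 * v" by (rule bruhat_factorization_mu)+
    show "\<forall>k. Suc k < n \<longrightarrow> ?c1 $$ (n - 1 - Suc k, n - 1 - k) - ?b1 $$ (n - 1 - Suc k, n - 1 - k) \<in> \<int>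
      \<and> ?c2 $$ (k, Suc k) - ?b2 $$ (k, Suc k) \<in> \<int>"
    proof (intro allI impI conjI)
      fix k assume k: "Suc k < n"
      then have k': "n - 1 - k = Suc (n - 1 - Suc k)" by simp
      have "u $$ (n - 1 - Suc k, Suc (n - 1 - Suc k)) \<in> \<int>"
        using uv(2)[unfolded elements_mat_subset_iff[OF c(1)]] k by simp
      then show "?c1 $$ (n - 1 - Suc k, n - 1 - k) - ?b1 $$ (n - 1 - Suc k, n - 1 - k) \<in> \<int>"
        unfolding mu k' using k by (subst unipotent_mult_superdiagonal[OF uv(1) g.b1]) auto
      show "?c2 $$ (k, Suc k) - ?b2 $$ (k, Suc k) \<in> \<int>"
        unfolding mu using k uv(4)[unfolded elements_mat_subset_iff[OF c(2)]]
        by (subst unipotent_mult_superdiagonal[OF g.b2 uv(3)]) auto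
    qed
  }
  {
    assume cong: "\<forall>k. Suc k < n \<longrightarrow> ?c1 $$ (n - 1 - Suc k, n - 1 - k) - ?b1 $$ (n - 1 - Suc k, n - 1 - k) \<in> \<int>
      \<and> ?c2 $$ (k, Suc k) - ?b2 $$ (k, Suc k) \<in> \<int>"
    obtain b1' where b1': "b1' \<in> unipotent n" "b1' * ?b1 = 1\<^sub>m n"
      using unipotent_inverse[OF real_subring_UNIV g.b1] by auto
    obtain b2' where b2': "b2' \<in> unipotent n" "?b2 * b2' = 1\<^sub>m n"
      using unipotent_inverse[OF real_subring_UNIV g.b2] by auto
    note b' = unipotentD(1)[OF b1'(1)] unipotentD(1)[OF b2'(1)]
    define u where "u = ?c1 * b1'"
    define v where "v = b2' * ?c2"
    have u: "u \<in> unipotent n" and v: "v \<in> unipotent n"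
      unfolding u_def v_def by (intro unipotent_mult b1' b2' h.b1 h.b2)+
    note c = unipotentD(1)[OF u] unipotentD(1)[OF v]
    have "u * ?b1 = ?c1 * (b1' * ?b1)" unfolding u_def using carr b' by (simp add: assoc)
    then have ub: "u * ?b1 = ?c1" unfolding b1'(2) using carr by simp
    have "?b2 * v = (?b2 * b2') * ?c2" unfolding v_def using carr b' by (simp add: assoc)
    then have bv: "?b2 * v = ?c2" unfolding b2'(2) using carr by simp
    have vR: "elements_mat v \<subseteq> localization p" if "prime p" for p
      using gf hf cong
      by (intro localization_integral_transition[OF _ _ _ _ n cop _ c(2) bv that]) auto
    have vZ: "elements_mat v \<subseteq> \<int>"
      using vR by (auto intro!: Ints_eq_Inter_localization)
    have "h = (u * ?b1) * (?W * (?b2 * v))" unfolding ub bv by (rule h.g_eq')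
    also have "\<dots> = u * (?b1 * (?W * ?b2)) * v" using carr c by (simp add: assoc)
    also have "?b1 * (?W * ?b2) = g" by (rule g.g_eq'[symmetric])
    finally have hu: "h = u * g * v" .
    have gv: "g * v \<in> carrier_mat n n" by (rule mult_carrier_mat[OF g.g_carrier c(2)])
    have gvZ: "elements_mat (g * v) \<subseteq> \<int>"
      using gf vZ by (intro elements_mat_mult[OF real_subring_Ints g.g_carrier c(2)]) auto
    have det: "det (g * v) = 1"
      by (simp add: det_mult[OF g.g_carrier c(2)] g.det_g det_unipotent[OF v])
    have one: "1 \<cdot>\<^sub>m 1\<^sub>m n = (1\<^sub>m n :: real mat)" by (rule eq_matI) auto
    have "h * adj_mat (g * v) = u * ((g * v) * adj_mat (g * v))"
      unfolding hu using carr c adj_mat(1)[OF gv] by (simp add: assoc)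
    also have "\<dots> = u" unfolding adj_mat(2)[OF gv] det one using c by simp
    finally have "u = h * adj_mat (g * v)" by simp
    then have uZ: "elements_mat u \<subseteq> \<int>"
      using hf elements_mat_mult[OF real_subring_Ints h.g_carrier adj_mat(1)[OF gv] _
          adj_mat_in_subring[OF real_subring_Ints gv gvZ]] by simp
    show "(g, h) \<in> double_coset_rel n D"
    proof -
      have "u \<in> unipotent_int n" "v \<in> unipotent_int n"
        using u v uZ vZ by (simp_all add: unipotent_int_iff)
      then show ?thesis unfolding double_coset_rel_def using g h hu by blast
    qed
  }
qed

section \<open>Realising prescribed residues\<close>

text \<open>Only the residues of the \<alpha>_k are prescribed: each is a unit modulo D_k, so the
  congruence of \<open>superdiagonal_congruence\<close> determines \<beta>_k modulo D_k. The
  induction splits off D_1 and applies the hypothesis to the shifted tuple.\<close>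

lemma bruhat_factorization_exists:
  assumes "1 \<le> n" "\<And>l. l \<le> n \<Longrightarrow> 0 < extend_tuple n D l"
    and "\<And>k. Suc k < n \<Longrightarrow> coprime (a (Suc k)) (int (extend_tuple n D (Suc k)))"
    and "\<And>k. Suc k < n \<Longrightarrow> coprime (extend_tuple n D (Suc k)) (extend_tuple n D (Suc (Suc k)))"
  shows "\<exists>b1 b2 g. bruhat_factorization n D b1 b2 g \<and> elements_mat g \<subseteq> \<int> \<and>
    (\<forall>k. Suc k < n \<longrightarrow> b1 $$ (n - 1 - Suc k, n - 1 - k)
        - of_int (a (Suc k)) / real (extend_tuple n D (Suc k)) \<in> \<int>)"
  using assms
proof (induction n arbitrary: D a rule: dec_induct)
  case base
  have "antidiag 1 (ratio 1 D) = 1\<^sub>m 1"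
    by (rule eq_matI) (auto simp: antidiag_def ratio_def extend_tuple_def)
  then have "1\<^sub>m 1 = 1\<^sub>m 1 * torus_element 1 D * long_weyl 1 * 1\<^sub>m 1"
    by (subst bruhat_product_eq) simp_all
  then have "bruhat_factorization 1 D (1\<^sub>m 1) (1\<^sub>m 1) (1\<^sub>m 1)"
    using base by (intro bruhat_factorization.intro one_unipotent)
  moreover have "elements_mat (1\<^sub>m 1 :: real mat) \<subseteq> \<int>"
    by (simp add: elements_mat_subset_iff[of _ 1 1])
  ultimately show ?case by (intro exI[of _ "1\<^sub>m 1"]) simp
next
  case (step n)
  let ?N = "Suc n" and ?D' = "\<lambda>l. D (Suc l)"
  from step.hyps obtain m where n: "n = Suc m" by (cases n) auto
  \<comment> \<open>The shift is compatible with the convention only away from 0: there the shifted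
    tuple has 1 in place of D_1.\<close>
  have ext: "extend_tuple n ?D' (Suc l) = extend_tuple ?N D (Suc (Suc l))" for l
    by (simp add: extend_tuple_def)
  have pos': "0 < extend_tuple n ?D' l" if "l \<le> n" for l
  proof (cases l)
    case (Suc l')
    show ?thesis unfolding Suc ext using that Suc by (intro step.prems(1)) simp
  qed (simp add: extend_tuple_def)
  have "\<exists>b1 b2 g. bruhat_factorization n ?D' b1 b2 g \<and> elements_mat g \<subseteq> \<int> \<and>
    (\<forall>k. Suc k < n \<longrightarrow> b1 $$ (n - 1 - Suc k, n - 1 - k)
        - of_int (a (Suc (Suc k))) / real (extend_tuple n ?D' (Suc k)) \<in> \<int>)"
    using step.prems(2,3) by (intro step.IH[where a = "\<lambda>k. a (Suc k)"] pos') (simp_all add: ext)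
  then obtain b1 b2 g where f: "bruhat_factorization n ?D' b1 b2 g" and gZ: "elements_mat g \<subseteq> \<int>"
    and b1a: "\<And>k. Suc k < n \<Longrightarrow> b1 $$ (n - 1 - Suc k, n - 1 - k)
        - of_int (a (Suc (Suc k))) / real (extend_tuple n ?D' (Suc k)) \<in> \<int>"
    by blast
  interpret bruhat_factorization n ?D' b1 b2 g by (rule f)
  define D1 where "D1 = extend_tuple ?N D 1"
  define D2 where "D2 = extend_tuple ?N D 2"
  have D1: "D1 > 0" and D2: "D2 > 0" using step.prems(1)[of 1] step.prems(1)[of 2] n by (simp_all add: D1_def D2_def)
  have cop: "coprime (int D2) (int D1)" "coprime (a 1) (int D1)"
    using step.prems(2,3)[of 0] n by (simp_all add: D1_def D2_def numeral_2_eq_2 coprime_commute)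
  \<comment> \<open>Modulo D_1, x is a_1 / D_2 and d is D_2 / a_1. Hence x d is 1 modulo D_1, so
    some y gives the rows (x, y) and (D_1, d) determinant 1; and s = x D_2 / D_1 agrees with a_1 /
    D_1 modulo 1.\<close>
  obtain e where e: "[int D2 * e = 1] (mod int D1)"
    using cong_solve_coprime_int[OF cop(1)] by blast
  obtain d' where d': "[a 1 * d' = 1] (mod int D1)"
    using cong_solve_coprime_int[OF cop(2)] by blast
  define x where "x = a 1 * e"
  define d where "d = int D2 * d'"
  have "[(int D2 * e) * (a 1 * d') = 1 * 1] (mod int D1)" by (rule cong_mult[OF e d'])
  then have "[x * d = 1] (mod int D1)" by (simp add: x_def d_def mult_ac)
  then have "int D1 dvd x * d - 1" by (simp add: cong_iff_dvd_diff)
  then obtain y where y: "x * d - 1 = int D1 * y" by (elim dvdE)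
  have "[(int D2 * e) * a 1 = 1 * a 1] (mod int D1)" by (rule cong_mult[OF e cong_refl])
  then have "int D1 dvd x * int D2 - a 1" by (simp add: x_def cong_iff_dvd_diff mult_ac)
  then obtain z where z: "x * int D2 - a 1 = int D1 * z" by (elim dvdE)
  define s where "s = of_int x * real D2 / real D1"
  \<comment> \<open>\<open>G = diag(g, 1) P h\<close> with \<open>P = s\<^sub>n \<cdots> s\<^sub>2\<close> a product of simple reflections and \<open>h\<close> the matrix with
    rows \<open>(x, y)\<close> and \<open>(D\<^sub>1, d)\<close> in the upper left corner; moving \<open>h\<close> past the factor \<open>b2\<close> of \<open>g\<close>
    gives \<open>B1\<close> and \<open>B2\<close>.\<close>
  define G where "G = mat ?N ?N (\<lambda>(i, j).
    if i < n then (if j = 0 then of_int x * g $$ (i, 0) else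
      if j = 1 then of_int y * g $$ (i, 0) else - g $$ (i, j - 1))
    else if j = 0 then real D1 else if j = 1 then of_int d else 0)"
  define B1 where "B1 = mat ?N ?N (\<lambda>(i, j).
    if i < n then (if j < n then b1 $$ (i, j) else s * b1 $$ (i, n - 1))
    else if j < n then 0 else 1)"
  define B2 where "B2 = mat ?N ?N (\<lambda>(i, j).
    if i = 0 then (if j = 0 then 1 else if j = 1 then of_int d / real D1 else 0)
    else if i = 1 then (if j = 0 then 0 else if j = 1 then 1 else real D1 * b2 $$ (0, j - 1))
    else if j \<le> 1 then 0 else b2 $$ (i - 1, j - 1))"
  have carr: "G \<in> carrier_mat ?N ?N" "B1 \<in> carrier_mat ?N ?N" "B2 \<in> carrier_mat ?N ?N"
    by (simp_all add: G_def B1_def B2_def)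
  have B1: "B1 \<in> unipotent ?N"
    by (rule unipotentI[OF carr(2)]) (use unipotentD(2,3)[OF b1] in \<open>auto simp: B1_def\<close>)
  have B2: "B2 \<in> unipotent ?N"
    by (rule unipotentI[OF carr(3)]) (use unipotentD(2,3)[OF b2] in \<open>auto simp: B2_def\<close>)
  \<comment> \<open>The weight D_2 / D_1 replaces the weight D_2 of the smaller matrix; the factor
    \<open>real D1\<close> in row 1 of \<open>B2\<close> compensates for this.\<close>
  have ratio0: "ratio ?N D 0 = real D1" "ratio ?N D (Suc 0) = real D2 / real D1"
    "ratio n ?D' 0 = real D2"
    by (simp_all add: ratio_def D1_def D2_def numeral_2_eq_2 ext) (simp_all add: extend_tuple_def)
  have ratio_Suc: "ratio ?N D (Suc (Suc l)) = ratio n ?D' (Suc l)" for l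
    by (simp add: ratio_def ext)
  \<comment> \<open>The terms l = 0 and l = 1 are split off. In rows i < n and columns j >= 2, term
    l = 0 vanishes and every term l+1 is minus term l of the smaller factorization at column j-1,
    whence \<open>- g\<close> in \<open>G\<close>.\<close>
  have "G = B1 * (antidiag ?N (ratio ?N D) * B2)"
  proof (rule eq_matI)
    fix i j assume "i < dim_row (B1 * (antidiag ?N (ratio ?N D) * B2))"
      "j < dim_col (B1 * (antidiag ?N (ratio ?N D) * B2))"
    then have ij: "i < ?N" "j < ?N" using carr by auto
    let ?F = "\<lambda>l. B1 $$ (i, ?N - 1 - l) * ((-1) ^ l * ratio ?N D l * B2 $$ (l, j))"
    have rhs: "(B1 * (antidiag ?N (ratio ?N D) * B2)) $$ (i, j) =
        ?F 0 + (?F 1 + (\<Sum>l<m. ?F (Suc (Suc l))))"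
      by (subst antidiag_product_entry[OF carr(2,3) ij])
        (simp only: n sum.lessThan_Suc_shift One_nat_def)
    show "G $$ (i, j) = (B1 * (antidiag ?N (ratio ?N D) * B2)) $$ (i, j)"
    proof (cases "i < n")
      case False
      then have "i = n" using ij by simp
      moreover have "(\<Sum>l<m. ?F (Suc (Suc l))) = 0"
        using \<open>i = n\<close> n by (intro sum.neutral) (auto simp: B1_def)
      ultimately show ?thesis
        unfolding rhs using ij n D1 by (simp add: G_def B1_def B2_def ratio0[unfolded n])
    next
      case i: True
      let ?F' = "\<lambda>l j. b1 $$ (i, n - 1 - l) * ((-1) ^ l * ratio n ?D' l * b2 $$ (l, j))"
      have g: "g $$ (i, j) = b1 $$ (i, m) * real D2 * b2 $$ (0, j) + (\<Sum>l<m. ?F' (Suc l) j)"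
        if "j < n" for j
      proof -
        have "g $$ (i, j) = ?F' 0 j + (\<Sum>l<m. ?F' (Suc l) j)"
          by (subst g_entry[OF i that]) (simp only: n sum.lessThan_Suc_shift)
        then show ?thesis using n ratio0(3)[unfolded n] by simp
      qed
      have g0: "g $$ (i, 0) = b1 $$ (i, m) * real D2"
      proof -
        have "(\<Sum>l<m. ?F' (Suc l) 0) = 0"
          using unipotentD(3)[OF b2, of 0] n by (intro sum.neutral) auto
        then show ?thesis using g[of 0] unipotentD(2)[OF b2, of 0] n by simp
      qed
      have F0: "?F 0 = s * b1 $$ (i, m) * real D1 * B2 $$ (0, j)"
        using i n by (simp add: B1_def ratio0[unfolded n])
      have F1: "?F 1 = - (b1 $$ (i, m) * (real D2 / real D1) * B2 $$ (1, j))"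
        using i n by (simp add: B1_def ratio0[unfolded n])
      consider "j = 0" | "j = 1" | "j \<ge> 2" by linarith
      then show ?thesis
      proof cases
        case 1
        have "(\<Sum>l<m. ?F (Suc (Suc l))) = 0"
          using 1 n by (intro sum.neutral) (auto simp: B2_def)
        then show ?thesis unfolding rhs F0 F1
          using 1 i n D1 by (simp add: G_def B2_def g0[unfolded n] s_def)
      next
        case 2
        have "(\<Sum>l<m. ?F (Suc (Suc l))) = 0"
          using 2 n by (intro sum.neutral) (auto simp: B2_def)
        moreover have "s * c * real D1 * (of_int d / real D1) - c * (real D2 / real D1) =
            of_int y * (c * real D2)" for c
        proof -
          have xd: "real_of_int x * of_int d - 1 = real D1 * of_int y"
            using arg_cong[OF y, of real_of_int] by simp
          have "s * c * real D1 * (of_int d / real D1) - c * (real D2 / real D1) =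
              c * real D2 * (real_of_int x * of_int d - 1) / real D1"
            using D1 by (simp add: s_def field_simps)
          then show ?thesis unfolding xd using D1 by simp
        qed
        ultimately show ?thesis unfolding rhs F0 F1
          using 2 i n by (simp add: G_def B2_def g0[unfolded n])
      next
        case 3
        have "?F (Suc (Suc l)) = - ?F' (Suc l) (j - 1)" if "l < m" for l
          using 3 i n ij that by (simp add: B1_def B2_def ratio_Suc[unfolded n] diff_less_Suc)
        then have "(\<Sum>l<m. ?F (Suc (Suc l))) = - (\<Sum>l<m. ?F' (Suc l) (j - 1))"
          unfolding sum_negf[symmetric] by (intro sum.cong) simp_all
        moreover have "j - 1 < n" using 3 ij by simp
        ultimately show ?thesis unfolding rhs F0 F1
          using 3 i n ij D1 g[of "j - 1"] by (simp add: G_def B2_def)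
      qed
    qed
  qed (use carr in auto)
  then have "G = B1 * torus_element ?N D * long_weyl ?N * B2"
    unfolding bruhat_product_eq[OF carr(2,3)] .
  then have "bruhat_factorization ?N D B1 B2 G"
    using B1 B2 step.prems(1) by unfold_locales
  moreover have "elements_mat G \<subseteq> \<int>"
    unfolding elements_mat_subset_iff[OF carr(1)]
    using gZ[unfolded elements_mat_subset_iff[OF g_carrier]] n by (auto simp: G_def)
  moreover have "B1 $$ (?N - 1 - Suc k, ?N - 1 - k)
      - of_int (a (Suc k)) / real (extend_tuple ?N D (Suc k)) \<in> \<int>" if k: "Suc k < ?N" for k
  proof (cases k)
    case 0
    have "of_int x * real D2 - of_int (a 1) = real D1 * of_int z"
      using arg_cong[OF z, of real_of_int] by simp
    then have "s - of_int (a 1) / real D1 = of_int z"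
      using D1 by (simp add: s_def field_simps)
    moreover have "B1 $$ (n - 1, n) = s"
      using n unipotentD(2)[OF b1, of "n - 1"] by (simp add: B1_def)
    ultimately show ?thesis using 0 by (simp add: D1_def)
  next
    case (Suc k')
    then have "B1 $$ (?N - 1 - Suc k, ?N - 1 - k) = b1 $$ (n - 1 - Suc k', n - 1 - k')"
      using k n by (simp add: B1_def diff_less_Suc)
    then show ?thesis using b1a[of k'] Suc k by (simp add: ext)
  qed
  ultimately show ?case by blast
qed

section \<open>Kloosterman sums over residues\<close>

lemma cexp2pi_conv_cis: "cexp2pi x = cis (2 * pi * x)"
  by (simp add: cexp2pi_def cis_conv_exp mult_ac)

lemma cexp2pi_add: "cexp2pi (x + y) = cexp2pi x * cexp2pi y"
  by (simp add: cexp2pi_conv_cis cis_mult distrib_left)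

lemma cexp2pi_sum: "cexp2pi (sum f A) = (\<Prod>x\<in>A. cexp2pi (f x))"
proof (induction A rule: infinite_finite_induct)
  case (insert x A)
  then show ?case by (simp add: cexp2pi_add)
qed (simp_all add: cexp2pi_conv_cis)

lemma cexp2pi_cong:
  assumes "x - y \<in> \<int>" shows "cexp2pi x = cexp2pi y"
proof -
  have "cexp2pi (x - y) = 1"
    unfolding cexp2pi_conv_cis using cis_multiple_2pi[OF assms] by simp
  then show ?thesis using cexp2pi_add[of y "x - y"] by simp
qed

lemma cexp2pi_mod:
  fixes m a :: int and d :: nat
  assumes "d > 0"
  shows "cexp2pi (of_int (m * (a mod int d)) / real d) = cexp2pi (of_int (m * a) / real d)"
proof (rule cexp2pi_cong)
  have "real_of_int a = of_int (a div int d) * real d + of_int (a mod int d)"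
    by (metis div_mult_mod_eq of_int_add of_int_mult of_int_of_nat_eq)
  then have "of_int (m * (a mod int d)) / real d - of_int (m * a) / real d
      = of_int (- m * (a div int d))"
    using assms by (simp add: field_simps)
  then show "of_int (m * (a mod int d)) / real d - of_int (m * a) / real d \<in> \<int>"
    by (metis Ints_of_int)
qed

section \<open>Pairs of residues with prescribed product\<close>

definition kloosterman_pairs :: "int \<Rightarrow> nat \<Rightarrow> (int \<times> int) set" where
  "kloosterman_pairs c d =
    {(a, b). a \<in> {0..<int d} \<and> b \<in> {0..<int d} \<and> [a * b = c] (mod int d)}"

lemma finite_kloosterman_pairs: "finite (kloosterman_pairs c d)"
  by (rule finite_subset[of _ "{0..<int d} \<times> {0..<int d}"]) (auto simp: kloosterman_pairs_def)

lemma kloosterman_pairs_mod: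
  assumes "0 < d" "[a * b = c] (mod int d)"
  shows "(a mod int d, b mod int d) \<in> kloosterman_pairs c d"
  using assms by (auto simp: kloosterman_pairs_def cong_def mod_mult_eq)

lemma kloosterman_pairs_coprime:
  assumes "(a, b) \<in> kloosterman_pairs c d" "coprime c (int d)"
  shows "coprime a (int d)"
proof -
  have "coprime (a * b) (int d)"
    using assms cong_imp_coprime[OF cong_sym, of "a * b" c "int d"]
    by (simp add: kloosterman_pairs_def)
  then show ?thesis by simp
qed

text \<open>The substitution of c a for a is invertible because c is a unit; it turns product 1 into
  product c, and the exponentials see only residues.\<close>

lemma sum_kloosterman_pairs_rescale:
  assumes d: "0 < d" and c: "coprime c (int d)"
  shows "(\<Sum>(a, b)\<in>kloosterman_pairs 1 d. cexp2pi (of_int (c * m * a + k * b) / real d)) =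
    (\<Sum>(a, b)\<in>kloosterman_pairs c d. cexp2pi (of_int (m * a + k * b) / real d))"
proof -
  obtain e where e: "[c * e = 1] (mod int d)" using cong_solve_coprime_int[OF c] by blast
  have inv: "(c * (e * a mod int d)) mod int d = a" "(e * (c * a mod int d)) mod int d = a"
    if "a \<in> {0..<int d}" for a
  proof -
    have "[c * e * a = 1 * a] (mod int d)" by (rule cong_mult[OF e cong_refl])
    then have "(c * e * a) mod int d = a" using that by (simp add: cong_def)
    then show "(c * (e * a mod int d)) mod int d = a" "(e * (c * a mod int d)) mod int d = a"
      by (simp_all add: mod_mult_right_eq mult_ac)
  qed
  show ?thesis
  proof (rule sum.reindex_bij_witness[where
        j = "\<lambda>(a, b). (c * a mod int d, b)" and i = "\<lambda>(a, b). (e * a mod int d, b)"])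
    fix x assume x: "x \<in> kloosterman_pairs 1 d"
    obtain a b where ab: "x = (a, b)" by (cases x)
    have mem: "a \<in> {0..<int d}" "b \<in> {0..<int d}" "[a * b = 1] (mod int d)"
      using x by (auto simp: ab kloosterman_pairs_def)
    show "(case case x of (a, b) \<Rightarrow> (c * a mod int d, b) of (a, b) \<Rightarrow> (e * a mod int d, b)) = x"
      using inv(2)[OF mem(1)] by (simp add: ab)
    have "[c * a * b = c] (mod int d)"
      using cong_mult[OF cong_refl[of c] mem(3)] by (simp add: mult_ac)
    then show "(case x of (a, b) \<Rightarrow> (c * a mod int d, b)) \<in> kloosterman_pairs c d"
      using kloosterman_pairs_mod[OF d, of "c * a" b c] mem(2) by (simp add: ab)
    have "cexp2pi (of_int (m * (c * a mod int d)) / real d) = cexp2pi (of_int (m * (c * a)) / real d)"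
      by (rule cexp2pi_mod[OF d])
    then show "(case case x of (a, b) \<Rightarrow> (c * a mod int d, b) of
        (a, b) \<Rightarrow> cexp2pi (of_int (m * a + k * b) / real d)) =
        (case x of (a, b) \<Rightarrow> cexp2pi (of_int (c * m * a + k * b) / real d))"
      by (simp add: ab add_divide_distrib cexp2pi_add mult_ac)
  next
    fix x assume x: "x \<in> kloosterman_pairs c d"
    obtain a b where ab: "x = (a, b)" by (cases x)
    have mem: "a \<in> {0..<int d}" "b \<in> {0..<int d}" "[a * b = c] (mod int d)"
      using x by (auto simp: ab kloosterman_pairs_def)
    show "(case case x of (a, b) \<Rightarrow> (e * a mod int d, b) of (a, b) \<Rightarrow> (c * a mod int d, b)) = x"
      using inv(1)[OF mem(1)] by (simp add: ab)
    have "[e * (a * b) = e * c] (mod int d)" by (rule cong_mult[OF cong_refl mem(3)])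
    also have "[e * c = 1] (mod int d)" using e by (simp add: mult.commute)
    finally have "[e * a * b = 1] (mod int d)" by (simp add: mult_ac)
    then show "(case x of (a, b) \<Rightarrow> (e * a mod int d, b)) \<in> kloosterman_pairs 1 d"
      using kloosterman_pairs_mod[OF d, of "e * a" b 1] mem(2) by (simp add: ab)
  qed
qed

text \<open>The classes of \<open>r\<close> are the nonempty fibres of \<phi>, so the image
  \<open>B\<close> indexes them.\<close>

lemma sum_quotient_by_invariant:
  assumes r: "\<And>x y. (x, y) \<in> r \<longleftrightarrow> x \<in> A \<and> y \<in> A \<and> \<phi> x = \<phi> y"
    and B: "\<phi> ` A = B"
    and F: "\<And>x. x \<in> A \<Longrightarrow> F {y \<in> A. \<phi> y = \<phi> x} = f (\<phi> x)"
  shows "sum F (A // r) = sum f B"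
proof -
  let ?h = "\<lambda>b. {y \<in> A. \<phi> y = b}"
  have cls: "r `` {x} = ?h (\<phi> x)" if "x \<in> A" for x
    using that r by auto
  have "bij_betw ?h B (A // r)"
  proof (rule bij_betw_imageI)
    show "inj_on ?h B"
    proof (rule inj_onI)
      fix b b' assume b: "b \<in> B" and "?h b = ?h b'"
      moreover obtain x where "x \<in> A" "\<phi> x = b" using b B by auto
      ultimately show "b = b'" by blast
    qed
    show "?h ` B = A // r"
      unfolding quotient_def B[symmetric] using cls by auto
  qed
  then have "sum F (A // r) = (\<Sum>b\<in>B. F (?h b))"
    by (rule sum.reindex_bij_betw[symmetric])
  also have "\<dots> = sum f B"
    using F B by (intro sum.cong) auto
  finally show ?thesis .
qed

text \<open>Bridge between matrix entries modulo 1, which describe double cosets, and numerators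
  modulo d, which index the finite sums.\<close>

lemma scaled_diff_Ints_iff:
  fixes d :: nat and a b :: int
  assumes "0 < d" "real d * x = of_int a" "real d * y = of_int b"
  shows "x - y \<in> \<int> \<longleftrightarrow> a mod int d = b mod int d"
proof -
  have *: "real d * (x - y) = of_int (a - b)"
    using assms(2,3) by (simp add: right_diff_distrib)
  have eq: "x - y = of_int k \<longleftrightarrow> a - b = int d * k" for k
  proof -
    have "x - y = of_int k \<longleftrightarrow> real d * (x - y) = real d * of_int k"
      using assms(1) by simp
    also have "\<dots> \<longleftrightarrow> real_of_int (a - b) = of_int (int d * k)"
      unfolding * by simp
    finally show ?thesis by (simp only: of_int_eq_iff)
  qed
  have "x - y \<in> \<int> \<longleftrightarrow> (\<exists>k. x - y = of_int k)" by (metis Ints_cases Ints_of_int)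
  also have "\<dots> \<longleftrightarrow> int d dvd a - b" unfolding eq dvd_def ..
  finally show ?thesis by (simp add: mod_eq_dvd_iff)
qed

text \<open>On the Bruhat cell the scaled entries are integers, so the floor functions only change the type.\<close>

definition cell_invariant :: "nat \<Rightarrow> (nat \<Rightarrow> nat) \<Rightarrow> real mat \<Rightarrow> nat \<Rightarrow> int \<times> int" where
  "cell_invariant n D g = (\<lambda>k\<in>{1..n-1}.
    (\<lfloor>real (D k) * mu n D g $$ (n - k - 1, n - k)\<rfloor> mod int (D k),
     \<lfloor>real (D k) * mu' n D g $$ (k - 1, k)\<rfloor> mod int (D k)))"

section \<open>The sum for pairwise coprime moduli as a product\<close>

locale coprime_moduli =
  fixes n :: nat and D :: "nat \<Rightarrow> nat"
  assumes n: "2 \<le> n" and moduli_pos: "\<And>i. i \<in> {1..n-1} \<Longrightarrow> 0 < D i"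
    and coprime_D: "pairwise (\<lambda>i j. coprime (D i) (D j)) {1..n-1}"
begin

lemma ext_pos: "l \<le> n \<Longrightarrow> 0 < extend_tuple n D l"
  using moduli_pos[of l] by (auto simp: extend_tuple_def)

lemma cell_iff:
  "g \<in> bruhat_cell n D \<longleftrightarrow>
    elements_mat g \<subseteq> \<int> \<and> bruhat_factorization n D (mu n D g) (mu' n D g) g"
  by (rule bruhat_cell_iff) (rule ext_pos)

definition neighbour_product :: "nat \<Rightarrow> int" where
  "neighbour_product k = int (extend_tuple n D (k - 1)) * int (extend_tuple n D (k + 1))"

lemma coprime_neighbour_product:
  assumes k: "k \<in> {1..n-1}"
  shows "coprime (neighbour_product k) (int (D k))"
proof -
  have "extend_tuple n D k = D k" using k by (auto simp: extend_tuple_def)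
  then have "coprime (extend_tuple n D (k - 1)) (D k)" "coprime (extend_tuple n D (k + 1)) (D k)"
    using k extend_tuple_coprime[OF coprime_D, of "k - 1" k] extend_tuple_coprime[OF coprime_D, of "k + 1" k]
    by auto
  then show ?thesis by (simp add: neighbour_product_def)
qed

lemma cell_superdiagonal:
  assumes g: "g \<in> bruhat_cell n D" and k: "k \<in> {1..n-1}"
  obtains \<alpha> \<beta> where "real (D k) * mu n D g $$ (n - k - 1, n - k) = of_int \<alpha>"
    "real (D k) * mu' n D g $$ (k - 1, k) = of_int \<beta>"
    "[\<alpha> * \<beta> = neighbour_product k] (mod int (D k))"
    "cell_invariant n D g k = (\<alpha> mod int (D k), \<beta> mod int (D k))"
proof -
  interpret bruhat_factorization n D "mu n D g" "mu' n D g" g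
    using g[unfolded cell_iff] by simp
  have gZ: "elements_mat g \<subseteq> \<int>" using g[unfolded cell_iff] by simp
  \<comment> \<open>Moduli are numbered from 1, matrix rows from 0; hence k = l + 1.\<close>
  obtain l where l: "k = Suc l" "Suc l < n" using k by (cases k) auto
  have ext: "extend_tuple n D (Suc l) = D k" using l by (simp add: extend_tuple_def)
  have idx: "n - 1 - Suc l = n - k - 1" "n - 1 - l = n - k" using l by auto
  note cong = superdiagonal_congruence[OF gZ l(2), unfolded ext idx]
  obtain \<alpha> where \<alpha>: "real (D k) * mu n D g $$ (n - k - 1, n - k) = of_int \<alpha>"
    using cong(1) by (elim Ints_cases)
  obtain \<beta> where \<beta>: "real (D k) * mu' n D g $$ (l, Suc l) = of_int \<beta>"
    using cong(2) by (elim Ints_cases)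
  obtain z where "(of_int \<alpha> * of_int \<beta> - E l * E (Suc (Suc l))) / real (D k) = of_int z"
    using cong(3) unfolding \<alpha> \<beta> by (elim Ints_cases)
  then have "of_int \<alpha> * of_int \<beta> - E l * E (Suc (Suc l)) = of_int z * real (D k)"
    using moduli_pos[OF k] by (simp add: field_simps)
  then have "real_of_int (\<alpha> * \<beta> - neighbour_product k) = of_int (z * int (D k))"
    by (simp add: neighbour_product_def l)
  then have "\<alpha> * \<beta> - neighbour_product k = z * int (D k)" by (simp only: of_int_eq_iff)
  then have c: "[\<alpha> * \<beta> = neighbour_product k] (mod int (D k))" by (simp add: cong_iff_dvd_diff)
  have "cell_invariant n D g k = (\<alpha> mod int (D k), \<beta> mod int (D k))"
    using k \<alpha> \<beta> l by (simp add: cell_invariant_def)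
  then show ?thesis using that[OF \<alpha> _ c] \<beta> l by simp
qed

lemma cell_invariant_eq_iff:
  assumes g: "g \<in> bruhat_cell n D" and h: "h \<in> bruhat_cell n D"
  shows "(g, h) \<in> double_coset_rel n D \<longleftrightarrow> cell_invariant n D g = cell_invariant n D h"
proof -
  let ?P = "\<lambda>k. mu n D h $$ (n - k - 1, n - k) - mu n D g $$ (n - k - 1, n - k) \<in> \<int>
      \<and> mu' n D h $$ (k - 1, k) - mu' n D g $$ (k - 1, k) \<in> \<int>"
  have "(g, h) \<in> double_coset_rel n D \<longleftrightarrow> (\<forall>k. Suc k < n \<longrightarrow> ?P (Suc k))"
    by (subst double_coset_rel_iff[OF _ n coprime_D g h]) (auto simp: ext_pos)
  also have "\<dots> \<longleftrightarrow> (\<forall>k\<in>{1..n-1}. ?P k)"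
  proof
    assume *: "\<forall>k. Suc k < n \<longrightarrow> ?P (Suc k)"
    show "\<forall>k\<in>{1..n-1}. ?P k"
    proof
      fix k assume "k \<in> {1..n-1}"
      then obtain l where "k = Suc l" "Suc l < n" by (cases k) auto
      then show "?P k" using * by blast
    qed
  next
    assume *: "\<forall>k\<in>{1..n-1}. ?P k"
    show "\<forall>k. Suc k < n \<longrightarrow> ?P (Suc k)"
      by (intro allI impI bspec[OF *]) auto
  qed
  also have "\<dots> \<longleftrightarrow> (\<forall>k\<in>{1..n-1}. cell_invariant n D g k = cell_invariant n D h k)"
  proof (rule ball_cong[OF refl])
    fix k assume k: "k \<in> {1..n-1}"
    obtain \<alpha> \<beta> where g': "real (D k) * mu n D g $$ (n - k - 1, n - k) = of_int \<alpha>"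
      "real (D k) * mu' n D g $$ (k - 1, k) = of_int \<beta>"
      "cell_invariant n D g k = (\<alpha> mod int (D k), \<beta> mod int (D k))"
      using cell_superdiagonal[OF g k] by metis
    obtain \<alpha>' \<beta>' where h': "real (D k) * mu n D h $$ (n - k - 1, n - k) = of_int \<alpha>'"
      "real (D k) * mu' n D h $$ (k - 1, k) = of_int \<beta>'"
      "cell_invariant n D h k = (\<alpha>' mod int (D k), \<beta>' mod int (D k))"
      using cell_superdiagonal[OF h k] by metis
    show "?P k \<longleftrightarrow> cell_invariant n D g k = cell_invariant n D h k"
      unfolding g'(3) h'(3) scaled_diff_Ints_iff[OF moduli_pos[OF k] h'(1) g'(1)]
        scaled_diff_Ints_iff[OF moduli_pos[OF k] h'(2) g'(2)] by auto
  qed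
  also have "\<dots> \<longleftrightarrow> cell_invariant n D g = cell_invariant n D h"
  proof
    assume "\<forall>k\<in>{1..n-1}. cell_invariant n D g k = cell_invariant n D h k"
    \<comment> \<open>Outside 1..n-1 both functions are \<open>undefined\<close> by
      restriction.\<close>
    then show "cell_invariant n D g = cell_invariant n D h"
      by (intro ext[where f = "cell_invariant n D g"]) (auto simp: cell_invariant_def restrict_def)
  qed simp
  finally show ?thesis .
qed

text \<open>One inclusion is the congruence. For the other, the first components are units, so some
  \<open>g\<close> in the cell realises them; its second components then agree with the given ones
  after cancelling \<open>a k\<close>.\<close>

lemma cell_invariant_image:
  "cell_invariant n D ` bruhat_cell n D =
    (\<Pi>\<^sub>E k\<in>{1..n-1}. kloosterman_pairs (neighbour_product k) (D k))" (is "_ = ?B")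
proof (intro equalityI subsetI)
  fix f assume "f \<in> cell_invariant n D ` bruhat_cell n D"
  then obtain g where g: "g \<in> bruhat_cell n D" and f: "f = cell_invariant n D g" by blast
  show "f \<in> ?B"
  proof (rule PiE_I)
    fix k assume k: "k \<in> {1..n-1}"
    obtain \<alpha> \<beta> where "[\<alpha> * \<beta> = neighbour_product k] (mod int (D k))"
      "cell_invariant n D g k = (\<alpha> mod int (D k), \<beta> mod int (D k))"
      using cell_superdiagonal[OF g k] by metis
    then show "f k \<in> kloosterman_pairs (neighbour_product k) (D k)"
      unfolding f using kloosterman_pairs_mod[OF moduli_pos[OF k]] by simp
  qed (auto simp: f cell_invariant_def)
next
  fix f assume f: "f \<in> ?B"
  define a where "a k = fst (f k)" for k
  have fk: "(a k, snd (f k)) \<in> kloosterman_pairs (neighbour_product k) (D k)" if "k \<in> {1..n-1}" for k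
    using PiE_mem[OF f that] by (simp add: a_def)
  have a: "coprime (a k) (int (D k))" if "k \<in> {1..n-1}" for k
    using kloosterman_pairs_coprime[OF fk coprime_neighbour_product] that by blast
  have "\<exists>b1 b2 g. bruhat_factorization n D b1 b2 g \<and> elements_mat g \<subseteq> \<int> \<and>
    (\<forall>k. Suc k < n \<longrightarrow> b1 $$ (n - 1 - Suc k, n - 1 - k)
        - of_int (a (Suc k)) / real (extend_tuple n D (Suc k)) \<in> \<int>)"
  proof (rule bruhat_factorization_exists)
    show "coprime (a (Suc k)) (int (extend_tuple n D (Suc k)))" if "Suc k < n" for k
      using a[of "Suc k"] that by (simp add: extend_tuple_def)
    show "coprime (extend_tuple n D (Suc k)) (extend_tuple n D (Suc (Suc k)))" if "Suc k < n" for k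
      using that by (intro extend_tuple_coprime[OF coprime_D]) auto
  qed (use n ext_pos in auto)
  then obtain b1 b2 g where fac: "bruhat_factorization n D b1 b2 g" and gZ: "elements_mat g \<subseteq> \<int>"
    and b1: "\<And>k. Suc k < n \<Longrightarrow> b1 $$ (n - 1 - Suc k, n - 1 - k)
        - of_int (a (Suc k)) / real (extend_tuple n D (Suc k)) \<in> \<int>" by blast
  note mu = bruhat_factorization_mu[OF fac]
  have g: "g \<in> bruhat_cell n D" using cell_iff fac gZ mu by simp
  have "f k = cell_invariant n D g k" for k
  proof (cases "k \<in> {1..n-1}")
    case k: True
    obtain l where l: "k = Suc l" "Suc l < n" using k by (cases k) auto
    have ext: "extend_tuple n D (Suc l) = D k" using l by (simp add: extend_tuple_def)
    have idx: "n - 1 - Suc l = n - k - 1" "n - 1 - l = n - k" using l by auto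
    obtain \<alpha> \<beta> where g': "real (D k) * b1 $$ (n - k - 1, n - k) = of_int \<alpha>"
      "[\<alpha> * \<beta> = neighbour_product k] (mod int (D k))"
      "cell_invariant n D g k = (\<alpha> mod int (D k), \<beta> mod int (D k))"
      using cell_superdiagonal[OF g k] mu by metis
    have "b1 $$ (n - k - 1, n - k) - of_int (a k) / real (D k) \<in> \<int>"
      using b1[OF l(2), unfolded ext idx] l by simp
    moreover have "real (D k) * (of_int (a k) / real (D k)) = of_int (a k)"
      using moduli_pos[OF k] by simp
    ultimately have \<alpha>: "\<alpha> mod int (D k) = a k mod int (D k)"
      using scaled_diff_Ints_iff[OF moduli_pos[OF k] g'(1)] by blast
    define b where "b = snd (f k)"
    have ab: "a k \<in> {0..<int (D k)}" "b \<in> {0..<int (D k)}"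
      "[a k * b = neighbour_product k] (mod int (D k))"
      using fk[OF k] by (simp_all add: kloosterman_pairs_def b_def)
    have "[a k * \<beta> = \<alpha> * \<beta>] (mod int (D k))"
      using \<alpha> by (intro cong_mult cong_refl) (simp add: cong_def)
    also note g'(2)
    also have "[neighbour_product k = a k * b] (mod int (D k))" by (rule cong_sym[OF ab(3)])
    finally have "[\<beta> = b] (mod int (D k))"
      using cong_mult_lcancel[OF a[OF k]] by blast
    then have "\<beta> mod int (D k) = b" using ab(2) by (simp add: cong_def)
    moreover have "\<alpha> mod int (D k) = a k" using \<alpha> ab(1) by simp
    ultimately show ?thesis using g'(3) by (simp add: a_def b_def)
  next
    case False
    then have "f k = undefined" using PiE_arb[OF f] by blast
    then show ?thesis using False by (auto simp: cell_invariant_def)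
  qed
  then show "f \<in> cell_invariant n D ` bruhat_cell n D" using g by blast
qed

lemma psi_mu:
  assumes g: "g \<in> bruhat_cell n D"
  shows "psi n (reverse_tuple n M) (mu n D g) =
      (\<Prod>k = 1..n-1. cexp2pi (of_int (M k * fst (cell_invariant n D g k)) / real (D k)))"
    and "psi n N (mu' n D g) =
      (\<Prod>k = 1..n-1. cexp2pi (of_int (N k * snd (cell_invariant n D g k)) / real (D k)))"
proof -
  have *: "cexp2pi (of_int (M k) * mu n D g $$ (n - k - 1, n - k)) =
      cexp2pi (of_int (M k * fst (cell_invariant n D g k)) / real (D k))"
    "cexp2pi (of_int (N k) * mu' n D g $$ (k - 1, k)) =
      cexp2pi (of_int (N k * snd (cell_invariant n D g k)) / real (D k))" if k: "k \<in> {1..n-1}" for k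
  proof -
    obtain \<alpha> \<beta> where g': "real (D k) * mu n D g $$ (n - k - 1, n - k) = of_int \<alpha>"
      "real (D k) * mu' n D g $$ (k - 1, k) = of_int \<beta>"
      "cell_invariant n D g k = (\<alpha> mod int (D k), \<beta> mod int (D k))"
      using cell_superdiagonal[OF g k] by metis
    note d = moduli_pos[OF k]
    have "mu n D g $$ (n - k - 1, n - k) = of_int \<alpha> / real (D k)"
      "mu' n D g $$ (k - 1, k) = of_int \<beta> / real (D k)"
      unfolding g'(1,2)[symmetric] using d by simp_all
    then show "cexp2pi (of_int (M k) * mu n D g $$ (n - k - 1, n - k)) =
      cexp2pi (of_int (M k * fst (cell_invariant n D g k)) / real (D k))"
    "cexp2pi (of_int (N k) * mu' n D g $$ (k - 1, k)) =
      cexp2pi (of_int (N k * snd (cell_invariant n D g k)) / real (D k))"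
      unfolding g'(3) fst_conv snd_conv cexp2pi_mod[OF d] by simp_all
  qed
  \<comment> \<open>Reversal matches M_k with the superdiagonal entry of \<open>mu\<close> in row
    n-k, counted from 1, which is the one with denominator D_k.\<close>
  have "(\<Sum>i = 1..n-1. of_int (reverse_tuple n M i) * mu n D g $$ (i - 1, i)) =
      (\<Sum>k = 1..n-1. of_int (M k) * mu n D g $$ (n - k - 1, n - k))"
    by (rule sum.reindex_bij_witness[where i = "\<lambda>i. n - i" and j = "\<lambda>i. n - i"])
      (auto simp: reverse_tuple_def)
  then show "psi n (reverse_tuple n M) (mu n D g) =
      (\<Prod>k = 1..n-1. cexp2pi (of_int (M k * fst (cell_invariant n D g k)) / real (D k)))"
    unfolding psi_def by (simp only: cexp2pi_sum) (intro prod.cong refl *(1))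
  show "psi n N (mu' n D g) =
      (\<Prod>k = 1..n-1. cexp2pi (of_int (N k * snd (cell_invariant n D g k)) / real (D k)))"
    unfolding psi_def cexp2pi_sum by (intro prod.cong refl *(2))
qed

text \<open>The invariant identifies the double cosets with a product set, and the summand is a
  product of factors in one coordinate each, so sum and product interchange.\<close>

lemma kloosterman_sum_eq:
  "kloosterman_sum n M N D = (\<Prod>k = 1..n-1.
    \<Sum>(a, b)\<in>kloosterman_pairs (neighbour_product k) (D k). cexp2pi (of_int (M k * a + N k * b) / real (D k)))"
proof -
  let ?t = "\<lambda>k (a, b). cexp2pi (of_int (M k * a + N k * b) / real (D k))"
  have "kloosterman_sum n M N D =
      (\<Sum>f\<in>(\<Pi>\<^sub>E k\<in>{1..n-1}. kloosterman_pairs (neighbour_product k) (D k)). \<Prod>k = 1..n-1. ?t k (f k))"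
    unfolding kloosterman_sum_def kloosterman_set_def
  proof (rule sum_quotient_by_invariant[OF _ cell_invariant_image])
    fix g h
    show "(g, h) \<in> double_coset_rel n D \<longleftrightarrow> g \<in> bruhat_cell n D \<and> h \<in> bruhat_cell n D \<and>
        cell_invariant n D g = cell_invariant n D h"
      using cell_invariant_eq_iff by (auto simp: double_coset_rel_def)
  next
    fix g assume g: "g \<in> bruhat_cell n D"
    let ?X = "{h \<in> bruhat_cell n D. cell_invariant n D h = cell_invariant n D g}"
    \<comment> \<open>By \<open>psi_mu\<close> the characters depend on the invariant alone, so
      their image on a fibre is a singleton.\<close>
    have "the_elem ((\<lambda>h. psi n (reverse_tuple n M) (mu n D h)) ` ?X) =
        psi n (reverse_tuple n M) (mu n D g)"
      using g psi_mu(1) by (intro the_elem_image_unique) auto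
    moreover have "the_elem ((\<lambda>h. psi n N (mu' n D h)) ` ?X) = psi n N (mu' n D g)"
      using g psi_mu(2) by (intro the_elem_image_unique) auto
    ultimately show "the_elem ((\<lambda>h. psi n (reverse_tuple n M) (mu n D h)) ` ?X) *
        the_elem ((\<lambda>h. psi n N (mu' n D h)) ` ?X) =
        (\<Prod>k = 1..n-1. ?t k (cell_invariant n D g k))"
      by (simp add: psi_mu[OF g] prod.distrib[symmetric] case_prod_beta add_divide_distrib cexp2pi_add)
  qed
  also have "\<dots> = (\<Prod>k = 1..n-1.
      \<Sum>x\<in>kloosterman_pairs (neighbour_product k) (D k). ?t k x)"
    by (rule prod_sum_PiE[symmetric]) (simp_all add: finite_kloosterman_pairs)
  finally show ?thesis .
qed

end

section \<open>The case n = 2 and the comparison of factors\<close>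

lemma kloosterman_sum2_eq:
  assumes "0 < d"
  shows "kloosterman_sum2 m k d =
    (\<Sum>(a, b)\<in>kloosterman_pairs 1 d. cexp2pi (of_int (m * a + k * b) / real d))"
proof -
  interpret coprime_moduli 2 "\<lambda>_. d"
    using assms by unfold_locales simp_all
  \<comment> \<open>Both neighbours of the only modulus are 1 by convention, so the pairs consist of
    mutually inverse residues, as in the classical Kloosterman sum.\<close>
  have "neighbour_product 1 = 1" by (simp add: neighbour_product_def extend_tuple_def)
  then show ?thesis unfolding kloosterman_sum2_def kloosterman_sum_eq by simp
qed

theorem corollary3p11:
  fixes n :: nat and M N :: "nat \<Rightarrow> int" and D :: "nat \<Rightarrow> nat"
  assumes "n \<ge> 2"
    and "\<And>i. i \<in> {1..n-1} \<Longrightarrow> D i > 0"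
    and "pairwise (\<lambda>i j. coprime (D i) (D j)) {1..n-1}"
  shows "kloosterman_sum n M N D =
    (\<Prod>i = 1..n-1. kloosterman_sum2
       (int (extend_tuple n D (i - 1)) * M i * int (extend_tuple n D (i + 1))) (N i) (D i))"
proof -
  interpret coprime_moduli n D
    using assms by unfold_locales
  show ?thesis
    unfolding kloosterman_sum_eq
  proof (rule prod.cong[OF refl])
    fix i assume i: "i \<in> {1..n-1}"
    have eq: "int (extend_tuple n D (i - 1)) * M i * int (extend_tuple n D (i + 1)) =
        neighbour_product i * M i"
      by (simp add: neighbour_product_def mult_ac)
    \<comment> \<open>Rescaling moves D_{i-1} D_{i+1} from the condition on the pairs into the first
      argument of S_2.\<close>
    show "(\<Sum>(a, b)\<in>kloosterman_pairs (neighbour_product i) (D i).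
        cexp2pi (of_int (M i * a + N i * b) / real (D i))) = kloosterman_sum2
       (int (extend_tuple n D (i - 1)) * M i * int (extend_tuple n D (i + 1))) (N i) (D i)"
      unfolding eq kloosterman_sum2_eq[OF moduli_pos[OF i]]
      by (rule sum_kloosterman_pairs_rescale[OF moduli_pos[OF i] coprime_neighbour_product[OF i],
            symmetric])
  qed
qed

end
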